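(* Let $T>0$, $I=[0,T]$, $\nu_1,\nu_2\in\mathbb{R}$ and $p>1$. Assume: (H1) $\Phi:\mathbb{R}\to\mathbb{R}$ is a strictly increasing homeomorphism; (H2) $A:W^{1,p}(I)\to C(I,\mathbb{R})$, $x\mapsto A_x$, is continuous with respect to the uniform topology of $C(I,\mathbb{R})$ on $W^{1,p}(I)\subseteq C(I,\mathbb{R})$, and there exist $h_1,h_2\in C(I,\mathbb{R})$ with $h_1,h_2\ge0$ on $I$, $1/h_1,1/h_2\in L^p(I)$, and $h_1(t)\le A_x(t)\le h_2(t)$ for every $x\in W^{1,p}(I)$ and every $t\in I$; (H3) $F:W^{1,p}(I)\to L^1(I)$, $x\mapsto F_x$, is continuous (usual norms) and there is a non-negative $\psi\in L^1(I)$ with $|F_x(t)|\le\psi(t)$ for every $x\in W^{1,p}(I)$ and a.e. $t\in I$. Then the boundary value problem $(\Phi(A_x(t)x'(t)))'=F_x(t)$ a.e. on $I$, $x(0)=\nu_1$, $x(T)=\nu_2$ admits at least one solution $x\in W^{1,p}(I)$.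
   Context: A continuous $x\in C(I,\mathbb{R})$ is a solution of this problem if $x\in W^{1,p}(I)$, $t\mapsto\Phi(A_x(t)x'(t))$ belongs to $W^{1,1}(I)$ (coincides a.e. with an absolutely continuous function), $(\Phi(A_x(t)x'(t)))'=F_x(t)$ for a.e. $t\in I$, and $x(0)=\nu_1$, $x(T)=\nu_2$. *)

theory Defs
  imports "HOL-Analysis.Analysis"
begin

text \<open>Functions on I = [0,T] are represented as real \<Rightarrow> real; only values on I matter.\<close>

definition Lp_on :: "real \<Rightarrow> real \<Rightarrow> (real \<Rightarrow> real) \<Rightarrow> bool" where
  "Lp_on p T g \<longleftrightarrow> g \<in> borel_measurable (lebesgue_on {0..T}) \<and>
      integrable (lebesgue_on {0..T}) (\<lambda>t. \<bar>g t\<bar> powr p)"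

definition Lp_norm :: "real \<Rightarrow> real \<Rightarrow> (real \<Rightarrow> real) \<Rightarrow> real" where
  "Lp_norm p T g = (integral\<^sup>L (lebesgue_on {0..T}) (\<lambda>t. \<bar>g t\<bar> powr p)) powr (1 / p)"

text \<open>g is the (weak) derivative of x in W^{1,p}(I), with x its continuous
  (absolutely continuous) representative: x(t) = x(0) + int_0^t g.\<close>
definition W1p_deriv :: "real \<Rightarrow> real \<Rightarrow> (real \<Rightarrow> real) \<Rightarrow> (real \<Rightarrow> real) \<Rightarrow> bool" where
  "W1p_deriv p T x g \<longleftrightarrow> Lp_on p T g \<and>
      (\<forall>t\<in>{0..T}. x t = x 0 + integral {0..t} g)"

definition W1p :: "real \<Rightarrow> real \<Rightarrow> (real \<Rightarrow> real) \<Rightarrow> bool" where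
  "W1p p T x \<longleftrightarrow> (\<exists>g. W1p_deriv p T x g)"

definition is_solution ::
  "real \<Rightarrow> real \<Rightarrow> (real \<Rightarrow> real) \<Rightarrow> ((real \<Rightarrow> real) \<Rightarrow> real \<Rightarrow> real)
     \<Rightarrow> ((real \<Rightarrow> real) \<Rightarrow> real \<Rightarrow> real) \<Rightarrow> real \<Rightarrow> real \<Rightarrow> (real \<Rightarrow> real) \<Rightarrow> bool" where
  "is_solution p T \<Phi> A F \<nu>1 \<nu>2 x \<longleftrightarrow>
     continuous_on {0..T} x \<and>
     (\<exists>g. W1p_deriv p T x g \<and>
        (\<exists>w v. W1p_deriv 1 T w v \<and>
           (AE t in lebesgue_on {0..T}. \<Phi> (A x t * g t) = w t) \<and>
           (AE t in lebesgue_on {0..T}. v t = F x t))) \<and>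
     x 0 = \<nu>1 \<and> x T = \<nu>2"

end

theory Submission
  imports Defs "HOL-Complex_Analysis.Great_Picard"
begin

text \<open>
  A solution is a triple \<open>(\<xi>, w, x)\<close> with \<open>w t = \<integral>\<^bsub>0\<^esub>\<^bsup>t\<^esup> F\<^sub>x\<close>,
  \<open>x' = \<Phi>\<^sup>-\<^sup>1 (\<xi> + w) / A\<^sub>x\<close>, \<open>x 0 = \<nu>1\<close> and \<open>x T = \<nu>2\<close>. Send \<open>(\<xi>, w, x)\<close> to
  \<open>(\<xi> + \<nu>2 - y T, \<integral> F\<^sub>y, y)\<close>, where \<open>y = \<nu>1 + \<integral> \<Phi>\<^sup>-\<^sup>1 (\<xi> + w) / A\<^sub>x\<close>, and truncate the
  first component to \<open>[- R, R]\<close>. Keeping \<open>\<xi>\<close> and \<open>w\<close> as unknowns makes the map continuous for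
  uniform convergence: by dominated convergence \<open>y\<close> depends continuously in \<open>W\<^sup>1\<^sup>,\<^sup>p\<close> on the
  triple, and so \<open>F\<^sub>y\<close> in \<open>L\<^sup>1\<close>. The bounds \<open>\<bar>F\<^sub>y\<bar> \<le> \<psi>\<close> and \<open>\<bar>y'\<bar> \<le> N / h1\<close> confine
  the image to a compact convex set of functions with dominated increments, all of which lie in
  \<open>W\<^sup>1\<^sup>,\<^sup>p\<close> by the Radon-Nikodym theorem. Schauder's theorem gives a fixed point, and for large
  \<open>R\<close> the truncation cannot be active there.
\<close>

subsection \<open>Schauder's fixed point theorem\<close>

text \<open>The library's Brouwer theorem fixes the dimension in the type, while Schauder's theorem needs
  cubes of unbounded dimension; hence the detour through Kuhn's combinatorial lemma.\<close>

lemma cube_approx_fixpoint: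
  fixes f :: "(nat \<Rightarrow> real) \<Rightarrow> nat \<Rightarrow> real"
  defines "C \<equiv> {x. \<forall>i. 0 \<le> x i \<and> x i \<le> 1}"
  assumes range: "\<And>x i. x \<in> C \<Longrightarrow> i < n \<Longrightarrow> 0 \<le> f x i \<and> f x i \<le> 1"
    and unif: "\<And>\<epsilon>. \<epsilon> > 0 \<Longrightarrow> \<exists>\<delta>>0. \<forall>x\<in>C. \<forall>y\<in>C. (\<forall>i<n. \<bar>x i - y i\<bar> < \<delta>) \<longrightarrow>
                  (\<forall>i<n. \<bar>f x i - f y i\<bar> < \<epsilon>)"
    and "\<epsilon> > 0"
  shows "\<exists>x\<in>C. \<forall>i<n. \<bar>f x i - x i\<bar> < \<epsilon>"
proof -
  obtain \<delta> where "\<delta> > 0" and \<delta>: "\<And>x y i. x \<in> C \<Longrightarrow> y \<in> C \<Longrightarrow> (\<forall>i<n. \<bar>x i - y i\<bar> < \<delta>) \<Longrightarrow>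
      i < n \<Longrightarrow> \<bar>f x i - f y i\<bar> < \<epsilon> / 2"
    using unif[of "\<epsilon> / 2"] \<open>\<epsilon> > 0\<close> by (auto simp: Ball_def)
  \<comment> \<open>The mesh \<open>1 / p\<close> has to stay below both the modulus of continuity
    \<open>\<delta>\<close> and \<open>\<epsilon> / 2\<close>.\<close>
  obtain p :: nat where p: "1 / min \<delta> (\<epsilon> / 2) < real p"
    using reals_Archimedean2 by blast
  have "min \<delta> (\<epsilon> / 2) > 0" using \<open>\<delta> > 0\<close> \<open>\<epsilon> > 0\<close> by auto
  then have "real p > 0" using p by (smt (verit) divide_pos_pos)
  then have "p > 0" by simp
  have pinv: "1 / real p < min \<delta> (\<epsilon> / 2)"
    using p \<open>min \<delta> (\<epsilon> / 2) > 0\<close> \<open>real p > 0\<close>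
    by (metis divide_less_eq mult.commute)
  then have pd: "1 / real p < \<delta>" and pe: "1 / real p < \<epsilon> / 2" by auto
  \<comment> \<open>\<open>sc q\<close> is the grid point \<open>q / p\<close>. Coordinates from
    \<open>n\<close> on are set to 0, since members of \<open>C\<close> carry infinitely many
    coordinates.\<close>
  define sc where "sc q i = (if i < n then real (q i) / real p else 0)" for q :: "nat \<Rightarrow> nat" and i
  \<comment> \<open>Label 0 says that \<open>f\<close> does not lower coordinate \<open>i\<close>.
    The clause \<open>q i \<noteq> p\<close> forces label 1 on the far face, which is Kuhn's
    boundary condition there.\<close>
  define lab where "lab q i = (if sc q i \<le> f (sc q) i \<and> q i \<noteq> p then 0 else 1 :: nat)" for q i
  have scC: "sc q \<in> C" if "\<forall>i<n. q i \<le> p" for q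
    using that \<open>p > 0\<close> by (auto simp: sc_def C_def)
  obtain q where q: "\<forall>i<n. q i < p"
    and q2: "\<forall>i<n. \<exists>r s. (\<forall>j<n. q j \<le> r j \<and> r j \<le> q j + 1) \<and>
        (\<forall>j<n. q j \<le> s j \<and> s j \<le> q j + 1) \<and> lab r i \<noteq> lab s i"
  proof (rule kuhn_lemma[OF \<open>p > 0\<close>, of n lab])
    show "\<forall>x. (\<forall>i<n. x i \<le> p) \<longrightarrow> (\<forall>i<n. x i = 0 \<longrightarrow> lab x i = 0)"
    proof (intro allI impI)
      fix x i assume "\<forall>i<n. x i \<le> p" "i < n" "x i = 0"
      then show "lab x i = 0"
        using range[OF scC, of x i] \<open>p > 0\<close> by (simp add: lab_def sc_def)
    qed
  qed (auto simp: lab_def)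
  have qC: "sc q \<in> C" using q scC by (simp add: less_imp_le)
  have "\<bar>f (sc q) i - sc q i\<bar> < \<epsilon>" if "i < n" for i
  proof -
    have key: "\<bar>f (sc r) i - f (sc q) i\<bar> < \<epsilon> / 2 \<and> 0 \<le> sc r i - sc q i \<and> sc r i - sc q i \<le> 1 / p
        \<and> sc r \<in> C"
      if r: "\<forall>j<n. q j \<le> r j \<and> r j \<le> q j + 1" for r
    proof -
      have rC: "sc r \<in> C" using q r by (intro scC) (metis Suc_eq_plus1 le_trans Suc_leI)
      have d: "0 \<le> sc r j - sc q j \<and> sc r j - sc q j \<le> 1 / p" if "j < n" for j
      proof -
        have "real (q j) \<le> real (r j)" "real (r j) \<le> real (q j) + 1" using r that by (metis of_nat_le_iff, metis of_nat_1 of_nat_add of_nat_le_iff)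
        then show ?thesis using that \<open>real p > 0\<close> by (simp add: sc_def divide_simps)
      qed
      have "\<forall>j<n. \<bar>sc r j - sc q j\<bar> < \<delta>" using d pd by fastforce
      then show ?thesis using \<delta>[OF rC qC] d that \<open>i < n\<close> rC by auto
    qed
    obtain r s where r: "\<forall>j<n. q j \<le> r j \<and> r j \<le> q j + 1" and s: "\<forall>j<n. q j \<le> s j \<and> s j \<le> q j + 1"
      and "lab r i \<noteq> lab s i" using q2 \<open>i < n\<close> by blast
    then consider "lab r i = 0" "lab s i = 1" | "lab s i = 0" "lab r i = 1"
      unfolding lab_def by (auto split: if_splits)
    then obtain r s where r: "\<forall>j<n. q j \<le> r j \<and> r j \<le> q j + 1" and s: "\<forall>j<n. q j \<le> s j \<and> s j \<le> q j + 1"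
      and l: "lab r i = 0" "lab s i = 1" using r s by cases auto
    \<comment> \<open>In one cell, \<open>f\<close> does not lower coordinate \<open>i\<close> at
      \<open>r\<close> and does not raise it at \<open>s\<close>. Both vertices lie within
      \<open>1 / p\<close> above \<open>q\<close>, and \<open>f\<close> varies by less than
      \<open>\<epsilon> / 2\<close> between each of them and \<open>q\<close>, so the displacement
      at \<open>q\<close> is squeezed below \<open>\<epsilon>\<close> from both sides.\<close>
    have "sc r i \<le> f (sc r) i" using l(1) by (auto simp: lab_def split: if_splits)
    moreover have "f (sc s) i \<le> sc s i"
    proof (cases "s i = p")
      case True
      then have "sc s i = 1" using \<open>p > 0\<close> \<open>i < n\<close> by (simp add: sc_def)
      then show ?thesis using range[of "sc s" i] key[OF s] \<open>i < n\<close> by auto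
    qed (use l(2) in \<open>auto simp: lab_def split: if_splits\<close>)
    ultimately show ?thesis using key[OF r] key[OF s] pe by linarith
  qed
  then show ?thesis using qC by blast
qed

text \<open>A partition of unity subordinate to a finite \<open>\<epsilon> / 2\<close>-net replaces
  \<open>f x\<close> by a convex combination of net points, at a cost below
  \<open>\<epsilon> / 2\<close>. Points of their hull are parametrised by weights in a cube, where
  the induced map on weights has an approximate fixed point; passing back to \<open>S\<close> costs
  another \<open>\<epsilon> / 2\<close>.\<close>

lemma Schauder_approx:
  fixes f :: "'a::real_normed_vector \<Rightarrow> 'a"
  assumes S: "compact S" "convex S" "S \<noteq> {}" and f: "continuous_on S f" "f ` S \<subseteq> S" and "\<epsilon> > 0"
  shows "\<exists>x\<in>S. dist (f x) x < \<epsilon>"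
proof -
  obtain Y where Y: "finite Y" "Y \<subseteq> S" "S \<subseteq> (\<Union>y\<in>Y. ball y (\<epsilon> / 2))"
  proof (rule compactE_image[OF S(1), of S "\<lambda>y. ball y (\<epsilon> / 2)"])
    show "S \<subseteq> (\<Union>y\<in>S. ball y (\<epsilon> / 2))" using \<open>\<epsilon> > 0\<close> by auto
  qed auto
  have "Y \<noteq> {}" using Y S(3) by auto
  obtain y :: "nat \<Rightarrow> 'a" and n0 where y: "Y = y ` {i. i < n0}"
    using finite_imp_nat_seg_image_inj_on[OF Y(1)] by blast
  then have "n0 > 0" using \<open>Y \<noteq> {}\<close> by auto
  then obtain n where n0: "n0 = Suc n" by (cases n0) auto
  have yS: "y i \<in> S" if "i \<le> n" for i using y n0 Y(2) that by auto
  \<comment> \<open>\<open>\<phi> i\<close> is a bump supported on the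
    \<open>\<epsilon> / 2\<close>-ball around \<open>y i\<close>; normalising the bumps at
    \<open>f x\<close> gives the weights \<open>g i x\<close>.\<close>
  define \<phi> where "\<phi> i z = max 0 (\<epsilon> / 2 - dist (y i) z)" for i z
  define \<Phi> where "\<Phi> z = (\<Sum>i\<le>n. \<phi> i z)" for z
  define g where "g i x = \<phi> i (f x) / \<Phi> (f x)" for i x
  have \<phi>0: "\<phi> i z \<ge> 0" for i z by (simp add: \<phi>_def)
  have \<Phi>pos: "\<Phi> z > 0" if "z \<in> S" for z
  proof -
    obtain i where "i \<le> n" "dist (y i) z < \<epsilon> / 2"
      using subsetD[OF Y(3), of z] \<open>z \<in> S\<close> y n0 by (auto simp: less_Suc_eq_le)
    then show ?thesis unfolding \<Phi>_def by (intro sum_pos2[of _ i]) (auto simp: \<phi>_def)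
  qed
  have fS: "f x \<in> S" if "x \<in> S" for x using f(2) that by auto
  have g0: "0 \<le> g i x" if "x \<in> S" for i x
    using \<phi>0 \<Phi>pos[OF fS[OF that]] by (simp add: g_def)
  have g1: "(\<Sum>i\<le>n. g i x) = 1" if "x \<in> S" for x
    using \<Phi>pos[OF fS[OF that]] by (simp add: g_def \<Phi>_def flip: sum_divide_distrib)
  have gle: "g i x \<le> 1" if "x \<in> S" "i \<le> n" for i x
    using member_le_sum[of i "{..n}" "\<lambda>i. g i x"] g1 g0 that by simp
  have "continuous_on S (g i)" for i
    unfolding g_def \<Phi>_def \<phi>_def using \<Phi>pos[OF fS] f(1)
    by (auto intro!: continuous_intros simp: \<Phi>_def \<phi>_def) (metis less_irrefl)
  then have gunif: "uniformly_continuous_on S (g i)" for i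
    by (intro compact_uniformly_continuous S)
  define C :: "(nat \<Rightarrow> real) set" where "C = {x. \<forall>i. 0 \<le> x i \<and> x i \<le> 1}"
  \<comment> \<open>Dividing by \<open>max 1 (\<Sum>i<n. c i)\<close> makes \<open>\<sigma>\<close> map the whole cube, not only a simplex, into \<open>S\<close>.\<close>
  define m where "m c = max 1 (\<Sum>i<n. c i)" for c :: "nat \<Rightarrow> real"
  define \<sigma> where "\<sigma> c = y n + (\<Sum>i<n. (c i / m c) *\<^sub>R (y i - y n))" for c
  have m1: "m c \<ge> 1" for c by (simp add: m_def)
  have \<sigma>S: "\<sigma> c \<in> S" if "c \<in> C" for c
  proof -
    define u where "u i = (if i < n then c i / m c else 1 - (\<Sum>i<n. c i / m c))" for i
    have "(\<Sum>i\<le>n. u i *\<^sub>R y i) \<in> S"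
    proof (rule convex_sum)
      have "(\<Sum>i<n. c i / m c) \<le> 1" unfolding sum_divide_distrib[symmetric]
        using m1[of c] by (simp add: m_def)
      then show "0 \<le> u i" for i using m1[of c] that by (auto simp: u_def C_def)
      show "sum u {..n} = 1" by (simp add: u_def flip: lessThan_Suc_atMost)
    qed (use S yS in auto)
    moreover have "(\<Sum>i\<le>n. u i *\<^sub>R y i) = \<sigma> c"
      by (simp add: u_def \<sigma>_def scaleR_diff_right scaleR_diff_left sum_subtractf scaleR_sum_left flip: lessThan_Suc_atMost)
    ultimately show ?thesis by simp
  qed
  obtain D where D: "D > 0" "\<And>i. i < n \<Longrightarrow> norm (y i - y n) \<le> D"
  proof
    show "(\<Sum>i<n. norm (y i - y n)) + 1 > 0" by (simp add: add_nonneg_pos sum_nonneg)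
    show "norm (y i - y n) \<le> (\<Sum>i<n. norm (y i - y n)) + 1" if "i < n" for i
      using member_le_sum[of i "{..<n}" "\<lambda>i. norm (y i - y n)"] that by simp
  qed
  \<comment> \<open>Three estimates make the dependence of \<open>\<sigma>\<close> on the weights
    explicit in the maximum norm: \<open>m\<close> has Lipschitz constant \<open>n\<close>, the
    quotients \<open>c i / m c\<close> have \<open>n + 1\<close>, and summing vectors of length at
    most \<open>D\<close> multiplies by \<open>n * D\<close>.\<close>
  have m_lip: "\<bar>m c - m c'\<bar> \<le> n * d" if "\<And>i. i < n \<Longrightarrow> \<bar>c i - c' i\<bar> \<le> d" for c c' and d :: real
  proof -
    have "\<bar>m c - m c'\<bar> \<le> \<bar>\<Sum>i<n. c i - c' i\<bar>" unfolding m_def sum_subtractf by linarith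
    also have "\<dots> \<le> (\<Sum>i<n. \<bar>c i - c' i\<bar>)" by (rule sum_abs)
    also have "\<dots> \<le> n * d" using sum_bounded_above[of "{..<n}" "\<lambda>i. \<bar>c i - c' i\<bar>" d] that by simp
    finally show ?thesis .
  qed
  have comb: "norm ((\<Sum>i<n. a i *\<^sub>R (y i - y n)) - (\<Sum>i<n. b i *\<^sub>R (y i - y n))) \<le> n * (d * D)"
    if "\<And>i. i < n \<Longrightarrow> \<bar>a i - b i\<bar> \<le> d" for a b :: "nat \<Rightarrow> real" and d
  proof -
    have "norm ((\<Sum>i<n. a i *\<^sub>R (y i - y n)) - (\<Sum>i<n. b i *\<^sub>R (y i - y n)))
        = norm (\<Sum>i<n. (a i - b i) *\<^sub>R (y i - y n))" by (simp add: sum_subtractf scaleR_diff_left)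
    also have "\<dots> \<le> (\<Sum>i<n. \<bar>a i - b i\<bar> * norm (y i - y n))"
      by (rule order_trans[OF norm_sum]) simp
    also have "\<dots> \<le> (\<Sum>i<n. d * D)"
      using that D by (intro sum_mono mult_mono) (auto intro: order_trans[OF abs_ge_zero])
    finally show ?thesis by simp
  qed
  have quot: "\<bar>c i / m c - c' i / m c'\<bar> \<le> (real n + 1) * d"
    if "c \<in> C" "c' \<in> C" "i < n" "\<And>i. i < n \<Longrightarrow> \<bar>c i - c' i\<bar> \<le> d" for c c' i and d :: real
  proof -
    have "c i / m c - c' i / m c' = (c i - c' i) / m c + c' i * (m c' - m c) / (m c * m c')"
      using m1[of c] m1[of c'] by (simp add: field_simps)
    also have "\<bar>\<dots>\<bar> \<le> \<bar>(c i - c' i) / m c\<bar> + \<bar>c' i * (m c' - m c) / (m c * m c')\<bar>" by (rule abs_triangle_ineq)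
    also have "\<dots> \<le> d / 1 + 1 * (n * d) / (1 * 1)"
      unfolding abs_divide abs_mult
      using that m1[of c] m1[of c'] m_lip[of c c' d, OF that(4)] order_trans[OF abs_ge_zero that(4)[OF that(3)]]
      by (intro add_mono frac_le mult_mono) (auto simp: C_def abs_minus_commute)
    finally show ?thesis by (simp add: algebra_simps)
  qed
  \<comment> \<open>Chosen so that \<open>(n + 1) * (n + 2) * \<delta> * D\<close> equals
    \<open>\<epsilon> / 2\<close>, which strictly exceeds the error bound
    \<open>n * (n + 1) * \<delta> * D\<close> obtained in \<open>d3\<close>, even for
    \<open>n = 0\<close>.\<close>
  define \<delta> where "\<delta> = \<epsilon> / (2 * (real n + 1) * ((real n + 2) * D))"
  have "\<delta> > 0" using \<open>\<epsilon> > 0\<close> D by (simp add: \<delta>_def)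
  have \<delta>_eq: "\<delta> * (2 * (real n + 1) * ((real n + 2) * D)) = \<epsilon>"
    unfolding \<delta>_def using D by (auto simp: add_nonneg_eq_0_iff)
  have "\<exists>c\<in>C. \<forall>i<n. \<bar>g i (\<sigma> c) - c i\<bar> < \<delta>"
  proof (rule cube_approx_fixpoint[of n "\<lambda>c i. g i (\<sigma> c)", folded C_def])
    show "0 \<le> g i (\<sigma> c) \<and> g i (\<sigma> c) \<le> 1" if "c \<in> C" "i < n" for c i
      using g0 gle \<sigma>S that by simp
    fix e :: real assume "e > 0"
    then have "\<exists>d>0. \<forall>x\<in>S. \<forall>x'\<in>S. dist x' x < d \<longrightarrow> dist (g i x') (g i x) < e" for i
      using gunif unfolding uniformly_continuous_on_def by blast
    then obtain d where d: "\<And>i. d i > 0"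
      "\<And>i x x'. x \<in> S \<Longrightarrow> x' \<in> S \<Longrightarrow> dist x' x < d i \<Longrightarrow> dist (g i x') (g i x) < e" by metis
    define d0 where "d0 = Min (insert 1 (d ` {..<n}))"
    have d0: "d0 > 0" "\<And>i. i < n \<Longrightarrow> d0 \<le> d i" using d(1) by (auto simp: d0_def)
    define d1 where "d1 = d0 / ((real n + 1) * ((real n + 1) * D))"
    have "d1 > 0" using d0 D by (simp add: d1_def)
    have d1_eq: "d1 * ((real n + 1) * ((real n + 1) * D)) = d0"
      unfolding d1_def using D by (auto simp: add_nonneg_eq_0_iff)
    have "dist (g i (\<sigma> c)) (g i (\<sigma> c')) < e"
      if "c \<in> C" "c' \<in> C" "\<forall>i<n. \<bar>c i - c' i\<bar> < d1" "i < n" for c c' i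
    proof (rule d(2))
      have "dist (\<sigma> c) (\<sigma> c') \<le> n * (((real n + 1) * d1) * D)"
        unfolding \<sigma>_def dist_norm add_diff_cancel_left using that
        by (intro comb quot) (auto intro: less_imp_le)
      also have "\<dots> < (real n + 1) * (((real n + 1) * d1) * D)" using \<open>d1 > 0\<close> D by (intro mult_strict_right_mono) auto
      also have "\<dots> = d0" using d1_eq by (simp add: mult_ac)
      finally show "dist (\<sigma> c) (\<sigma> c') < d i" using d0 that by fastforce
    qed (use \<sigma>S that in auto)
    then show "\<exists>\<delta>>0. \<forall>x\<in>C. \<forall>y\<in>C. (\<forall>i<n. \<bar>x i - y i\<bar> < \<delta>) \<longrightarrow>
                  (\<forall>i<n. \<bar>g i (\<sigma> x) - g i (\<sigma> y)\<bar> < e)"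
      using \<open>d1 > 0\<close> by (auto simp: dist_real_def)
  qed fact
  then obtain c where c: "c \<in> C" "\<And>i. i < n \<Longrightarrow> \<bar>g i (\<sigma> c) - c i\<bar> < \<delta>" by blast
  define x where "x = \<sigma> c"
  have xS: "x \<in> S" using \<sigma>S c by (simp add: x_def)
  have split: "(\<Sum>i\<le>n. g i x *\<^sub>R (y i - y n)) = (\<Sum>i<n. g i x *\<^sub>R (y i - y n))"
    by (simp flip: lessThan_Suc_atMost)
  have d1: "dist (f x) (\<Sum>i\<le>n. g i x *\<^sub>R y i) < \<epsilon> / 2"
  proof -
    have "f x - (\<Sum>i\<le>n. g i x *\<^sub>R y i) = (\<Sum>i\<le>n. g i x *\<^sub>R (f x - y i))"
      using g1[OF xS] by (simp add: scaleR_diff_right sum_subtractf flip: scaleR_sum_left)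
    also have "norm \<dots> \<le> (\<Sum>i\<le>n. g i x * norm (f x - y i))"
      using g0[OF xS] by (intro order_trans[OF norm_sum]) simp
    also have "\<dots> < (\<Sum>i\<le>n. g i x * (\<epsilon> / 2))"
    proof (rule sum_strict_mono_ex1)
      \<comment> \<open>Only net points closer than \<open>\<epsilon> / 2\<close> to
        \<open>f x\<close> carry weight. As the weights sum to 1, some weight is positive, which
        makes the inequality strict.\<close>
      have *: "dist (y i) (f x) < \<epsilon> / 2" if "g i x \<noteq> 0" for i
        using that by (auto simp: g_def \<phi>_def max_def split: if_splits)
      then show "\<forall>i\<in>{..n}. g i x * norm (f x - y i) \<le> g i x * (\<epsilon> / 2)"
        using g0[OF xS] by (metis dist_commute dist_norm less_imp_le mult_left_mono mult_zero_left order_refl)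
      obtain i where i: "i \<le> n" "g i x \<noteq> 0" using g1[OF xS] by (metis atMost_iff sum.neutral zero_neq_one)
      then show "\<exists>i\<in>{..n}. g i x * norm (f x - y i) < g i x * (\<epsilon> / 2)"
        using g0[OF xS, of i] *[OF i(2)] by (intro bexI[of _ i]) (auto simp: dist_norm norm_minus_commute)
    qed simp
    also have "\<dots> = \<epsilon> / 2" using g1[OF xS] by (simp flip: sum_distrib_right sum_divide_distrib)
    finally show ?thesis by (simp add: dist_norm)
  qed
  have d2: "(\<Sum>i\<le>n. g i x *\<^sub>R y i) = y n + (\<Sum>i<n. g i x *\<^sub>R (y i - y n))"
    using g1[OF xS] unfolding split[symmetric] by (simp add: scaleR_diff_right sum_subtractf flip: scaleR_sum_left)
  have d3: "dist (y n + (\<Sum>i<n. g i x *\<^sub>R (y i - y n))) x < \<epsilon> / 2"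
  proof -
    \<comment> \<open>\<open>x\<close> is built from the weights \<open>c i / m c\<close>, whereas
      \<open>c\<close> approximates \<open>g i x\<close>. Since the latter sum to 1, the normaliser
      \<open>m c\<close> exceeds 1 by at most \<open>n * \<delta>\<close>.\<close>
    have mle: "m c \<le> 1 + n * \<delta>"
    proof -
      have "(\<Sum>i<n. c i) \<le> (\<Sum>i<n. g i x + \<delta>)"
        using c(2) by (intro sum_mono) (smt (verit, best) lessThan_iff x_def)
      also have "\<dots> \<le> (\<Sum>i\<le>n. g i x) + n * \<delta>"
        using g0[OF xS] by (simp add: sum.distrib flip: lessThan_Suc_atMost)
      finally show ?thesis using g1[OF xS] \<open>\<delta> > 0\<close> by (simp add: m_def)
    qed
    have "\<bar>g i x - c i / m c\<bar> \<le> (real n + 1) * \<delta>" if "i < n" for i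
    proof -
      have ci: "0 \<le> c i" "c i \<le> 1" using c(1) by (auto simp: C_def)
      have "c i - c i / m c = c i / m c * (m c - 1)" using m1[of c] by (simp add: field_simps)
      also have "\<dots> \<le> 1 * (n * \<delta>)"
        using ci m1[of c] mle by (intro mult_mono) auto
      finally have "c i - c i / m c \<le> n * \<delta>" by simp
      moreover have "c i / m c \<le> c i" using ci m1[of c] divide_left_mono[of 1 "m c" "c i"] by simp
      ultimately show ?thesis using c(2)[OF that] by (simp add: x_def algebra_simps)
    qed
    then have "dist (y n + (\<Sum>i<n. g i x *\<^sub>R (y i - y n))) x \<le> n * (((real n + 1) * \<delta>) * D)"
      unfolding x_def[symmetric] by (subst (2) x_def, unfold \<sigma>_def dist_norm add_diff_cancel_left) (rule comb, auto)
    also have "\<dots> < (real n + 1) * (((real n + 2) * \<delta>) * D)" using \<open>\<delta> > 0\<close> D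
      by (intro mult_strict_mono' mult_strict_right_mono mult_nonneg_nonneg) auto
    also have "\<dots> = \<epsilon> / 2" using \<delta>_eq by (simp add: algebra_simps)
    finally show ?thesis .
  qed
  have "dist (f x) x < \<epsilon>"
    using d1 d3 dist_triangle[of "f x" x] unfolding d2 by (smt (verit) field_sum_of_halves)
  then show ?thesis using xS by blast
qed

text \<open>The displacement attains its minimum on the compact set, and approximate fixed points
  rule out a positive minimum.\<close>

theorem Schauder_fixpoint:
  fixes f :: "'a::real_normed_vector \<Rightarrow> 'a"
  assumes S: "compact S" "convex S" "S \<noteq> {}" and f: "continuous_on S f" "f ` S \<subseteq> S"
  obtains x where "x \<in> S" "f x = x"
proof -
  have "continuous_on S (\<lambda>x. dist (f x) x)" using f by (intro continuous_intros)
  then obtain x where x: "x \<in> S" "\<And>y. y \<in> S \<Longrightarrow> dist (f x) x \<le> dist (f y) y"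
    using continuous_attains_inf[OF S(1,3)] by blast
  have "\<not> dist (f x) x > 0"
    using Schauder_approx[OF S f, of "dist (f x) x"] x by force
  then show ?thesis using that x by simp
qed

subsection \<open>Functions with dominated increments\<close>

definition clamp_interval :: "real \<Rightarrow> real \<Rightarrow> real" where
  "clamp_interval T t = max 0 (min T t)"

text \<open>The inequality is imposed on the whole line, so an \<open>H\<close> that is constant
  outside \<open>{0..T}\<close> forces every member to be constant there as well.\<close>

definition dominated_bcontfun :: "real \<Rightarrow> (real \<Rightarrow> real) \<Rightarrow> (real \<Rightarrow>\<^sub>C real) set" where
  "dominated_bcontfun c H = {x :: real \<Rightarrow>\<^sub>C real. x 0 = c \<and> (\<forall>s t. \<bar>x s - x t\<bar> \<le> \<bar>H s - H t\<bar>)}"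

lemma convex_dominated_bcontfun: "convex (dominated_bcontfun c H)"
proof (rule convexI)
  fix x y and u v :: real
  assume *: "x \<in> dominated_bcontfun c H" "y \<in> dominated_bcontfun c H" "0 \<le> u" "0 \<le> v" "u + v = 1"
  have "\<bar>u * x s + v * y s - (u * x t + v * y t)\<bar> \<le> \<bar>H s - H t\<bar>" for s t
  proof -
    have "\<bar>u * x s + v * y s - (u * x t + v * y t)\<bar> = \<bar>u * (x s - x t) + v * (y s - y t)\<bar>"
      by (simp add: algebra_simps)
    also have "\<dots> \<le> u * \<bar>x s - x t\<bar> + v * \<bar>y s - y t\<bar>"
      using * by (intro order_trans[OF abs_triangle_ineq]) (simp add: abs_mult)
    also have "\<dots> \<le> u * \<bar>H s - H t\<bar> + v * \<bar>H s - H t\<bar>"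
      using * by (intro add_mono mult_left_mono) (auto simp: dominated_bcontfun_def)
    also have "\<dots> = \<bar>H s - H t\<bar>" using * by (simp flip: distrib_right)
    finally show ?thesis .
  qed
  moreover have "u * c + v * c = c" using * by (simp flip: distrib_right)
  ultimately show "u *\<^sub>R x + v *\<^sub>R y \<in> dominated_bcontfun c H"
    using * by (simp add: dominated_bcontfun_def)
qed

lemma dominated_in_bcontfun:
  fixes H x :: "real \<Rightarrow> real"
  assumes H: "continuous_on {0..T} H" "\<And>t. H t = H (clamp_interval T t)" and "0 \<le> T"
    and x: "\<And>s t. \<bar>x s - x t\<bar> \<le> \<bar>H s - H t\<bar>"
  shows "x \<in> bcontfun"
proof (rule bcontfun_normI)
  have cl: "clamp_interval T t \<in> {0..T}" for t using \<open>0 \<le> T\<close> by (auto simp: clamp_interval_def)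
  have "continuous_on UNIV (\<lambda>t. H (clamp_interval T t))"
    using cl by (intro continuous_on_compose2[OF H(1)]) (auto simp: clamp_interval_def intro!: continuous_intros)
  then have Hc: "continuous_on UNIV H" using H(2) by simp
  show "continuous_on UNIV x"
    unfolding continuous_on_iff
  proof (intro ballI allI impI)
    fix s e :: real assume "e > 0"
    then obtain d where "d > 0" "\<forall>t. dist t s < d \<longrightarrow> dist (H t) (H s) < e"
      using Hc unfolding continuous_on_iff by (metis UNIV_I)
    then show "\<exists>d>0. \<forall>t\<in>UNIV. dist t s < d \<longrightarrow> dist (x t) (x s) < e"
      using x by (auto simp: dist_real_def intro!: exI[of _ d] intro: le_less_trans)
  qed
  show "norm (x t) \<le> \<bar>x 0\<bar> + 2 * (SUP t\<in>{0..T}. \<bar>H t\<bar>)" for t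
  proof -
    have "compact ((\<lambda>t. \<bar>H t\<bar>) ` {0..T})"
      using H(1) by (intro compact_continuous_image continuous_intros) auto
    then have "bdd_above ((\<lambda>t. \<bar>H t\<bar>) ` {0..T})"
      by (intro bounded_imp_bdd_above compact_imp_bounded)
    then have "\<bar>H s\<bar> \<le> (SUP t\<in>{0..T}. \<bar>H t\<bar>)" for s
      using cSUP_upper[OF cl[of s]] H(2)[of s] by metis
    from this[of t] this[of 0] show ?thesis using x[of t 0] by simp
  qed
qed

text \<open>Arzela-Ascoli: \<open>H\<close> and the fixed value at 0 supply a common bound, and
  \<open>H\<close> a common modulus of continuity. Every member factors through
  \<open>clamp_interval T\<close>, so uniform convergence on \<open>{0..T}\<close> is already
  uniform on the line.\<close>

lemma compact_dominated_bcontfun: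
  assumes H: "continuous_on {0..T} H" "\<And>t. H t = H (clamp_interval T t)" and "0 \<le> T"
  shows "compact (dominated_bcontfun c H)"
  unfolding compact_eq_seq_compact_metric seq_compact_def
proof (intro allI impI)
  fix f :: "nat \<Rightarrow> real \<Rightarrow>\<^sub>C real" assume "\<forall>n. f n \<in> dominated_bcontfun c H"
  then have f: "\<And>n. f n 0 = c" "\<And>n s t. \<bar>f n s - f n t\<bar> \<le> \<bar>H s - H t\<bar>"
    by (auto simp: dominated_bcontfun_def)
  have cl: "clamp_interval T t \<in> {0..T}" for t using \<open>0 \<le> T\<close> by (auto simp: clamp_interval_def)
  have fcl: "f n t = f n (clamp_interval T t)" for n t
    using f(2)[of n t "clamp_interval T t"] H(2)[of t] by simp
  have "bounded (H ` {0..T})" using H(1) by (simp add: compact_continuous_image compact_imp_bounded)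
  then obtain B where B: "\<And>t. t \<in> {0..T} \<Longrightarrow> \<bar>H t\<bar> \<le> B"
    unfolding bounded_iff by (metis image_eqI real_norm_def)
  obtain g k where g: "strict_mono (k :: nat \<Rightarrow> nat)"
    "\<And>e. 0 < e \<Longrightarrow> \<exists>N. \<forall>n x. n \<ge> N \<and> x \<in> {0..T} \<longrightarrow> norm (f (k n) x - g x) < e"
  proof (rule Arzela_Ascoli[of "{0..T}" "\<lambda>n t. f n t" "\<bar>c\<bar> + 2 * B"])
    show "norm (f n t) \<le> \<bar>c\<bar> + 2 * B" if "t \<in> {0..T}" for n t
      using f(2)[of n t 0] f(1)[of n] B[OF that] B[of 0] \<open>0 \<le> T\<close> by auto
    fix t e :: real assume "t \<in> {0..T}" "0 < e"
    then obtain d where "d > 0" "\<forall>s\<in>{0..T}. dist s t < d \<longrightarrow> dist (H s) (H t) < e"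
      using H(1) unfolding continuous_on_iff by blast
    then show "\<exists>d>0. \<forall>n s. s \<in> {0..T} \<and> norm (t - s) < d \<longrightarrow> norm (f n t - f n s) < e"
      using order.strict_trans1[OF f(2)] by (intro exI[of _ d]) (auto simp: dist_real_def abs_minus_commute)
  qed auto
  define h where "h t = g (clamp_interval T t)" for t
  have unif: "\<exists>N. \<forall>n\<ge>N. \<forall>t. \<bar>f (k n) t - h t\<bar> < e" if "e > 0" for e
    using g(2)[OF that] cl fcl unfolding h_def by (metis real_norm_def)
  have lim: "(\<lambda>n. f (k n) t) \<longlonglongrightarrow> h t" for t
    unfolding LIMSEQ_iff using unif by (metis real_norm_def)
  have h0: "h 0 = c" using LIMSEQ_unique[OF lim[of 0]] f(1) by simp
  have hH: "\<bar>h s - h t\<bar> \<le> \<bar>H s - H t\<bar>" for s t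
    by (rule tendsto_upperbound[OF tendsto_rabs[OF tendsto_diff[OF lim lim]]]) (use f(2) in auto)
  then have hb: "h \<in> bcontfun" by (rule dominated_in_bcontfun[OF H \<open>0 \<le> T\<close>])
  have "(\<lambda>n. f (k n)) \<longlonglongrightarrow> Bcontfun h"
    by (intro uniform_limit_tendsto_bcontfun)
      (use unif in \<open>auto simp: uniform_limit_iff eventually_sequentially Bcontfun_inverse[OF hb] dist_real_def\<close>)
  moreover have "Bcontfun h \<in> dominated_bcontfun c H"
    using h0 hH by (simp add: dominated_bcontfun_def Bcontfun_inverse[OF hb])
  ultimately show "\<exists>l\<in>dominated_bcontfun c H. \<exists>r. strict_mono r \<and> (f \<circ> r) \<longlonglongrightarrow> l"
    using g(1) by (auto simp: o_def)
qed

text \<open>The sum of the two Stieltjes measures is packaged as a measure \<open>S\<close>.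
  Half-open intervals are stable under intersection and generate the Borel sets, so agreement of
  \<open>N\<close> and \<open>S\<close> on them suffices.\<close>

lemma emeasure_interval_measure_sum:
  fixes F G :: "real \<Rightarrow> real"
  assumes F: "\<And>x y. x \<le> y \<Longrightarrow> F x \<le> F y" "\<And>a. continuous (at_right a) F"
    and G: "\<And>x y. x \<le> y \<Longrightarrow> G x \<le> G y" "\<And>a. continuous (at_right a) G"
    and N: "sets N = sets borel"
      "\<And>a b. a \<le> b \<Longrightarrow> emeasure N {a<..b} = ennreal (F b - F a) + ennreal (G b - G a)"
    and A: "A \<in> sets borel"
  shows "emeasure N A = emeasure (interval_measure F) A + emeasure (interval_measure G) A"
proof -
  let ?\<mu> = "\<lambda>A. emeasure (interval_measure F) A + emeasure (interval_measure G) A"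
  define S where "S = measure_of UNIV (sets borel) ?\<mu>"
  let ?G = "range (\<lambda>(a, b). {a <.. b::real})"
  have sg: "sets borel = sigma_sets UNIV ?G" by (simp add: borel_sigma_sets_Ioc)
  have emS: "emeasure S A = ?\<mu> A" if "A \<in> sets borel" for A
  proof (rule emeasure_measure_of[OF S_def])
    show "countably_additive (sets S) ?\<mu>"
    proof (rule countably_additiveI)
      fix B :: "nat \<Rightarrow> real set" assume "range B \<subseteq> sets S" "disjoint_family B"
      moreover have "sets S = sets borel" unfolding S_def using sets.sets_measure_of_eq[of borel] by simp
      ultimately show "(\<Sum>i. ?\<mu> (B i)) = ?\<mu> (\<Union> (range B))"
        by (subst suminf_add[symmetric]) (auto simp: suminf_emeasure)
    qed
    have "sets S = sets borel" unfolding S_def using sets.sets_measure_of_eq[of borel] by simp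
    then show "A \<in> sets S" using that by simp
  qed (auto simp: positive_def)
  have "N = S"
  proof (rule measure_eqI_generator_eq[of ?G UNIV N S "\<lambda>n. {- real n<..real n}"])
    show "Int_stable ?G" by (auto simp: Int_stable_def image_iff)
    show "sets S = sigma_sets UNIV ?G" unfolding sg[symmetric] S_def
      using sets.sets_measure_of_eq[of borel] by simp
    show "(\<Union>n. {- real n<..real n}) = UNIV"
    proof (intro equalityI subsetI UNIV_I)
      fix x :: real
      obtain n where "\<bar>x\<bar> < real n" using reals_Archimedean2 by blast
      then show "x \<in> (\<Union>n. {- real n<..real n})" by (auto intro!: exI[of _ n])
    qed
    fix X assume "X \<in> ?G"
    then obtain a b where X: "X = {a<..b}" by auto
    show "emeasure N X = emeasure S X"
    proof (cases "a \<le> b")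
      case True
      then show ?thesis unfolding X N(2)[OF True]
        by (simp add: emS emeasure_interval_measure_Ioc_eq[OF F] emeasure_interval_measure_Ioc_eq[OF G])
    qed (simp add: X)
  qed (use N sg in auto)
  then show ?thesis using emS A by simp
qed

text \<open>Both \<open>H + x\<close> and \<open>H - x\<close> are nondecreasing, so their Stieltjes measures add up to the
  measure with density \<open>2 k\<close>; in particular both are absolutely continuous.\<close>

lemma dominated_increments_density:
  fixes x k H :: "real \<Rightarrow> real"
  assumes k: "integrable lborel k" "\<And>t. 0 \<le> k t"
    and H: "continuous_on UNIV H" "\<And>s t. s \<le> t \<Longrightarrow> set_lebesgue_integral lborel {s<..t} k = H t - H s"
    and x: "continuous_on UNIV x" "\<And>s t. s \<le> t \<Longrightarrow> \<bar>x t - x s\<bar> \<le> H t - H s"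
  obtains g where "g \<in> borel_measurable borel" "\<And>t. \<bar>g t\<bar> \<le> k t"
    "\<And>s t. s \<le> t \<Longrightarrow> set_lebesgue_integral lborel {s<..t} g = x t - x s"
proof -
  have [measurable]: "k \<in> borel_measurable borel" using k(1) by auto
  define F where "F t = H t + x t" for t
  define G where "G t = H t - x t" for t
  have F: "\<And>s t. s \<le> t \<Longrightarrow> F s \<le> F t" "\<And>a. continuous (at_right a) F"
    and G: "\<And>s t. s \<le> t \<Longrightarrow> G s \<le> G t" "\<And>a. continuous (at_right a) G"
  proof -
    show "F s \<le> F t" "G s \<le> G t" if "s \<le> t" for s t using x(2)[OF that] by (auto simp: F_def G_def)
    show "continuous (at_right a) F" "continuous (at_right a) G" for a
      using H(1) x(1) unfolding F_def G_def
      by (auto intro!: continuous_intros simp: continuous_on_eq_continuous_within intro: continuous_at_imp_continuous_at_within)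
  qed
  define N where "N = density lborel (\<lambda>t. ennreal (2 * k t))"
  have setsN: "sets N = sets borel" by (simp add: N_def)
  have kint: "(\<integral>\<^sup>+t. ennreal (k t * indicator {s<..t'} t) \<partial>lborel) = ennreal (H t' - H s)"
    if "s \<le> t'" for s t'
  proof -
    have "integrable lborel (\<lambda>t. k t * indicator {s<..t'} t)"
      using k(1) by (intro integrable_real_mult_indicator) auto
    then show ?thesis
      using H(2)[OF that] k(2) by (subst nn_integral_eq_integral) (auto simp: set_lebesgue_integral_def mult.commute)
  qed
  have Nioc: "emeasure N {s<..t} = ennreal (F t - F s) + ennreal (G t - G s)" if "s \<le> t" for s t
  proof -
    have "emeasure N {s<..t} = (\<integral>\<^sup>+u. 2 * ennreal (k u * indicator {s<..t} u) \<partial>lborel)"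
      unfolding N_def by (subst emeasure_density) (auto intro!: nn_integral_cong simp: indicator_def ennreal_mult k(2))
    also have "\<dots> = ennreal (2 * (H t - H s))"
      using ennreal_mult[of 2 "H t - H s"] x(2)[OF that] by (subst nn_integral_cmult) (auto simp: kint[OF that] simp del: right_diff_distrib_numeral)
    also have "2 * (H t - H s) = (F t - F s) + (G t - G s)" by (simp add: F_def G_def)
    also have "ennreal \<dots> = ennreal (F t - F s) + ennreal (G t - G s)"
      using F(1)[OF that] G(1)[OF that] by (simp add: ennreal_plus)
    finally show ?thesis .
  qed
  have sum: "emeasure N A = emeasure (interval_measure F) A + emeasure (interval_measure G) A"
    if "A \<in> sets borel" for A
    by (rule emeasure_interval_measure_sum[OF F G setsN Nioc that])
  have ac: "absolutely_continuous lborel M"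
    if "sets M = sets borel" "\<And>A. A \<in> sets borel \<Longrightarrow> emeasure M A \<le> emeasure N A" for M
    unfolding absolutely_continuous_def
  proof
    fix A assume A: "A \<in> null_sets (lborel :: real measure)"
    have "absolutely_continuous lborel N" unfolding N_def by (rule absolutely_continuousI_density) auto
    then have "emeasure N A = 0" using A by (auto simp: absolutely_continuous_def)
    then show "A \<in> null_sets M" using that(1) that(2)[of A] A by (auto simp: null_sets_def)
  qed
  have "\<exists>f\<in>borel_measurable lborel. density lborel f = interval_measure F"
    by (intro sigma_finite_measure.Radon_Nikodym[OF sigma_finite_lborel] ac) (auto simp: sum)
  then obtain f1 where f1[measurable]: "f1 \<in> borel_measurable borel" and f1d: "density lborel f1 = interval_measure F"
    by auto
  have "\<exists>f\<in>borel_measurable lborel. density lborel f = interval_measure G"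
    by (intro sigma_finite_measure.Radon_Nikodym[OF sigma_finite_lborel] ac) (auto simp: sum)
  then obtain f2 where f2[measurable]: "f2 \<in> borel_measurable borel" and f2d: "density lborel f2 = interval_measure G"
    by auto
  have "density lborel (\<lambda>t. f1 t + f2 t) = N"
  proof (rule measure_eqI)
    fix A assume "A \<in> sets (density lborel (\<lambda>t. f1 t + f2 t))"
    then have [measurable]: "A \<in> sets borel" by simp
    have "emeasure (density lborel (\<lambda>t. f1 t + f2 t)) A = emeasure (density lborel f1) A + emeasure (density lborel f2) A"
      by (simp add: emeasure_density distrib_right nn_integral_add)
    then show "emeasure (density lborel (\<lambda>t. f1 t + f2 t)) A = emeasure N A"
      unfolding f1d f2d by (simp add: sum)
  qed (simp add: setsN)
  then have ae: "AE t in lborel. f1 t + f2 t = ennreal (2 * k t)"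
    unfolding N_def by (intro sigma_finite_measure.density_unique[OF sigma_finite_lborel]) auto
  \<comment> \<open>\<open>f1\<close> is the density of \<open>H + x\<close> and \<open>k\<close>
    that of \<open>H\<close>, so \<open>f1 - k\<close> is the density of \<open>x\<close>. From
    \<open>f1 + f2 = 2 * k\<close> a.e. it is bounded by \<open>k\<close> a.e.; the value 0 on the
    exceptional null set makes the bound hold everywhere.\<close>
  define g where "g t = (if \<bar>enn2real (f1 t) - k t\<bar> \<le> k t then enn2real (f1 t) - k t else 0)" for t
  have g_ae: "AE t in lborel. ennreal (g t + k t) = f1 t"
    using ae
  proof eventually_elim
    fix t assume *: "f1 t + f2 t = ennreal (2 * k t)"
    then have le: "f1 t \<le> ennreal (2 * k t)" by (metis le_iff_add)
    then have fin: "ennreal (enn2real (f1 t)) = f1 t"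
      by (intro ennreal_enn2real) (simp add: le_less_trans)
    then have "enn2real (f1 t) \<le> 2 * k t" using le k(2)[of t] by (metis ennreal_le_iff mult_nonneg_nonneg zero_le_numeral)
    then have "\<bar>enn2real (f1 t) - k t\<bar> \<le> k t" using k(2)[of t] enn2real_nonneg[of "f1 t"] by linarith
    then show "ennreal (g t + k t) = f1 t" using fin by (simp add: g_def)
  qed
  show thesis
  proof
    show gm: "g \<in> borel_measurable borel" unfolding g_def by measurable
    show gk: "\<bar>g t\<bar> \<le> k t" for t using k(2)[of t] by (simp add: g_def)
    fix s t :: real assume st: "s \<le> t"
    have gint: "integrable lborel g"
      by (rule Bochner_Integration.integrable_bound[OF k(1)]) (use gm gk k(2) in auto)
    have i1: "integrable lborel (\<lambda>u. indicator {s<..t} u * (g u + k u))"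
      using gint k(1) by (intro integrable_mult_indicator[where 'b=real, simplified]) auto
    have gk0: "0 \<le> g u + k u" for u using gk[of u] by linarith
    have "ennreal (\<integral>u. indicator {s<..t} u * (g u + k u) \<partial>lborel) = (\<integral>\<^sup>+u. ennreal (indicator {s<..t} u * (g u + k u)) \<partial>lborel)"
      by (rule nn_integral_eq_integral[symmetric, OF i1]) (use gk0 in auto)
    also have "\<dots> = (\<integral>\<^sup>+u. f1 u * indicator {s<..t} u \<partial>lborel)"
      by (rule nn_integral_cong_AE, use g_ae in eventually_elim) (auto simp: indicator_def)
    also have "\<dots> = emeasure (interval_measure F) {s<..t}" unfolding f1d[symmetric] by (simp add: emeasure_density)
    also have "\<dots> = ennreal (F t - F s)" by (rule emeasure_interval_measure_Ioc[OF st F])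
    finally have "(\<integral>u. indicator {s<..t} u * (g u + k u) \<partial>lborel) = F t - F s"
      using F(1)[OF st] gk0 by (subst (asm) ennreal_inj) auto
    moreover have "(\<integral>u. indicator {s<..t} u * (g u + k u) \<partial>lborel) =
        set_lebesgue_integral lborel {s<..t} g + set_lebesgue_integral lborel {s<..t} k"
      unfolding set_lebesgue_integral_def distrib_left real_scaleR_def
      using gint k(1) by (intro Bochner_Integration.integral_add integrable_mult_indicator[where 'b=real, simplified]) auto
    ultimately show "set_lebesgue_integral lborel {s<..t} g = x t - x s"
      using H(2)[OF st] by (simp add: F_def)
  qed
qed

subsection \<open>Primitives and convergence in the Sobolev space\<close>

lemma lebesgue_on_interval_integrable_const [simp]:
  "integrable (lebesgue_on {a..b::real}) (\<lambda>_. c :: real)"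
  by (intro finite_measure.integrable_const finite_measure_lebesgue_on) auto

lemma Lp_on_mono:
  assumes "Lp_on p T k" "0 \<le> p" "g \<in> borel_measurable (lebesgue_on {0..T})"
    and "AE t in lebesgue_on {0..T}. \<bar>g t\<bar> \<le> \<bar>k t\<bar>"
  shows "Lp_on p T g"
  unfolding Lp_on_def
proof
  have "integrable (lebesgue_on {0..T}) (\<lambda>t. \<bar>k t\<bar> powr p)" using assms by (simp add: Lp_on_def)
  then show "integrable (lebesgue_on {0..T}) (\<lambda>t. \<bar>g t\<bar> powr p)"
  proof (rule Bochner_Integration.integrable_bound)
    show "(\<lambda>t. \<bar>g t\<bar> powr p) \<in> borel_measurable (lebesgue_on {0..T})" using assms(3) by measurable
    show "AE t in lebesgue_on {0..T}. norm (\<bar>g t\<bar> powr p) \<le> norm (\<bar>k t\<bar> powr p)"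
      using assms(4) by eventually_elim (use assms(2) in \<open>auto intro: powr_mono2\<close>)
  qed
qed fact

text \<open>The interval has finite measure and
  \<open>\<bar>u\<bar> \<le> 1 + \<bar>u\<bar> powr p\<close>.\<close>

lemma Lp_on_integrable:
  assumes "Lp_on p T g" "1 \<le> p"
  shows "integrable (lebesgue_on {0..T}) g"
proof (rule Bochner_Integration.integrable_bound)
  show "integrable (lebesgue_on {0..T}) (\<lambda>t. 1 + \<bar>g t\<bar> powr p)"
    using assms by (auto simp: Lp_on_def)
  have "\<bar>u\<bar> \<le> 1 + \<bar>u\<bar> powr p" for u :: real
  proof (cases "\<bar>u\<bar> \<le> 1")
    case False
    then have "\<bar>u\<bar> powr 1 \<le> \<bar>u\<bar> powr p" using assms(2) by (intro powr_mono) auto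
    then show ?thesis using False by simp
  qed (simp add: add_increasing2)
  then show "AE t in lebesgue_on {0..T}. norm (g t) \<le> norm (1 + \<bar>g t\<bar> powr p)"
    by (intro AE_I2) (simp add: abs_of_nonneg add_nonneg_nonneg)
qed (use assms in \<open>auto simp: Lp_on_def\<close>)

lemma Lp_on_one_iff: "Lp_on 1 T g \<longleftrightarrow> integrable (lebesgue_on {0..T}) g"
proof
  show "integrable (lebesgue_on {0..T}) g \<Longrightarrow> Lp_on 1 T g" unfolding Lp_on_def by simp
qed (rule Lp_on_integrable[of 1], simp_all)

lemma Lp_on_cmult:
  assumes "Lp_on p T k"
  shows "Lp_on p T (\<lambda>t. c * k t)"
  using assms by (auto simp: Lp_on_def abs_mult powr_mult)

text \<open>The integrands are dominated by \<open>\<bar>2 * k t\<bar> powr p\<close>. The integral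
  form serves at exponent 1, for uniform convergence of primitives; the norm form serves for the two
  terms of the Sobolev norm.\<close>

lemma Lp_dominated_convergence:
  assumes "1 \<le> p" and k: "Lp_on p T k"
    and g: "g \<in> borel_measurable (lebesgue_on {0..T})" "AE t in lebesgue_on {0..T}. \<bar>g t\<bar> \<le> k t"
    and gn: "\<And>n. gn n \<in> borel_measurable (lebesgue_on {0..T})"
      "\<And>n. AE t in lebesgue_on {0..T}. \<bar>gn n t\<bar> \<le> k t"
    and lim: "AE t in lebesgue_on {0..T}. (\<lambda>n. gn n t) \<longlonglongrightarrow> g t"
  shows "(\<lambda>n. \<integral>t. \<bar>gn n t - g t\<bar> powr p \<partial>lebesgue_on {0..T}) \<longlonglongrightarrow> 0"
    and "(\<lambda>n. Lp_norm p T (\<lambda>t. gn n t - g t)) \<longlonglongrightarrow> 0"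
proof -
  have "(\<lambda>n. \<integral>t. \<bar>gn n t - g t\<bar> powr p \<partial>lebesgue_on {0..T}) \<longlonglongrightarrow> (\<integral>t. 0 \<partial>lebesgue_on {0..T})"
  proof (rule integral_dominated_convergence[where w = "\<lambda>t. \<bar>2 * k t\<bar> powr p"])
    show "integrable (lebesgue_on {0..T}) (\<lambda>t. \<bar>2 * k t\<bar> powr p)"
      using Lp_on_cmult[OF k, of 2] by (simp add: Lp_on_def)
    show "AE t in lebesgue_on {0..T}. (\<lambda>n. \<bar>gn n t - g t\<bar> powr p) \<longlonglongrightarrow> 0"
      using lim
    proof eventually_elim
      fix t assume "(\<lambda>n. gn n t) \<longlonglongrightarrow> g t"
      then have "(\<lambda>n. gn n t - g t) \<longlonglongrightarrow> g t - g t" by (intro tendsto_intros)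
      then have "(\<lambda>n. \<bar>gn n t - g t\<bar>) \<longlonglongrightarrow> 0" using tendsto_rabs_zero by fastforce
      then have "(\<lambda>n. \<bar>gn n t - g t\<bar> powr p) \<longlonglongrightarrow> 0 powr p"
        using \<open>1 \<le> p\<close> by (intro tendsto_powr2) auto
      then show "(\<lambda>n. \<bar>gn n t - g t\<bar> powr p) \<longlonglongrightarrow> 0" by simp
    qed
    show "AE t in lebesgue_on {0..T}. norm (\<bar>gn n t - g t\<bar> powr p) \<le> \<bar>2 * k t\<bar> powr p" for n
      using g(2) gn(2)[of n] by eventually_elim (use \<open>1 \<le> p\<close> in \<open>auto intro!: powr_mono2\<close>)
    show "(\<lambda>t. \<bar>gn n t - g t\<bar> powr p) \<in> borel_measurable (lebesgue_on {0..T})" for n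
      using g(1) gn(1)[of n] by measurable
  qed auto
  then show *: "(\<lambda>n. \<integral>t. \<bar>gn n t - g t\<bar> powr p \<partial>lebesgue_on {0..T}) \<longlonglongrightarrow> 0" by simp
  have "(\<lambda>n. (\<integral>t. \<bar>gn n t - g t\<bar> powr p \<partial>lebesgue_on {0..T}) powr (1 / p)) \<longlonglongrightarrow> 0 powr (1 / p)"
    using \<open>1 \<le> p\<close> by (intro tendsto_powr2[OF *]) auto
  then show "(\<lambda>n. Lp_norm p T (\<lambda>t. gn n t - g t)) \<longlonglongrightarrow> 0" by (simp add: Lp_norm_def)
qed

text \<open>Extending functions from \<open>{0..T}\<close> by constants places them in the Banach space
  \<open>real \<Rightarrow>\<^sub>C real\<close>.\<close>

definition primitive :: "real \<Rightarrow> real \<Rightarrow> (real \<Rightarrow> real) \<Rightarrow> real \<Rightarrow> real" where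
  "primitive T c g t = c + integral {0..clamp_interval T t} g"

lemma clamp_interval_mem: "0 \<le> T \<Longrightarrow> clamp_interval T t \<in> {0..T}"
  by (auto simp: clamp_interval_def)

lemma clamp_interval_id [simp]: "t \<in> {0..T} \<Longrightarrow> clamp_interval T t = t"
  by (auto simp: clamp_interval_def)

lemma clamp_interval_mono: "s \<le> t \<Longrightarrow> clamp_interval T s \<le> clamp_interval T t"
  by (auto simp: clamp_interval_def)

lemma primitive_at_0 [simp]: "0 \<le> T \<Longrightarrow> primitive T c g 0 = c"
  by (simp add: primitive_def)

lemma primitive_clamp: "0 \<le> T \<Longrightarrow> primitive T c g t = primitive T c g (clamp_interval T t)"
  by (simp only: primitive_def clamp_interval_id[OF clamp_interval_mem])

lemma lebesgue_on_integrable_subinterval: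
  fixes g :: "real \<Rightarrow> real"
  assumes "integrable (lebesgue_on {0..T}) g" "{a..b} \<subseteq> {0..T}"
  shows "g absolutely_integrable_on {a..b}"
proof (rule set_integrable_subset)
  show "g absolutely_integrable_on {0..T}"
    using assms(1) by (simp add: set_integrable_def integrable_restrict_space)
qed (use assms(2) in auto)

lemma primitive_diff:
  assumes "integrable (lebesgue_on {0..T}) g" "0 \<le> T" "s \<le> t"
  shows "primitive T c g t - primitive T c g s = integral {clamp_interval T s..clamp_interval T t} g"
proof -
  let ?s = "clamp_interval T s" and ?t = "clamp_interval T t"
  have "?s \<in> {0..T}" "?t \<in> {0..T}" "?s \<le> ?t"
    using assms by (auto intro: clamp_interval_mem clamp_interval_mono simp del: atLeastAtMost_iff)
  then have "integral {0..?s} g + integral {?s..?t} g = integral {0..?t} g"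
    using assms by (intro Henstock_Kurzweil_Integration.integral_combine set_lebesgue_integral_eq_integral(1)
        lebesgue_on_integrable_subinterval) auto
  then show ?thesis by (simp add: primitive_def)
qed

lemma continuous_on_primitive:
  assumes "integrable (lebesgue_on {0..T}) g" "0 \<le> T"
  shows "continuous_on {0..T} (primitive T c g)"
proof -
  have "continuous_on {0..T} (\<lambda>t. c + integral {0..t} g)"
    using assms by (intro continuous_intros indefinite_integral_continuous_1 set_lebesgue_integral_eq_integral(1)
        lebesgue_on_integrable_subinterval) auto
  then show ?thesis by (rule continuous_on_eq) (simp add: primitive_def)
qed

lemma primitive_increment_le:
  assumes g: "integrable (lebesgue_on {0..T}) g" and k: "integrable (lebesgue_on {0..T}) k"
    and T: "0 \<le> T" and le: "AE t in lebesgue_on {0..T}. \<bar>g t\<bar> \<le> k t"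
  shows "\<bar>primitive T c g s - primitive T c g t\<bar> \<le> \<bar>primitive T d k s - primitive T d k t\<bar>"
proof -
  have *: "\<bar>primitive T c g t - primitive T c g s\<bar> \<le> primitive T d k t - primitive T d k s" if "s \<le> t" for s t
  proof -
    let ?I = "{clamp_interval T s..clamp_interval T t}"
    have I: "?I \<subseteq> {0..T}" using T by (auto simp: clamp_interval_def)
    have int: "integrable (lebesgue_on ?I) g" "integrable (lebesgue_on ?I) k"
      using lebesgue_on_integrable_subinterval[OF _ I] g k by (auto simp: set_integrable_def integrable_restrict_space)
    have ae: "AE u in lebesgue_on ?I. \<bar>g u\<bar> \<le> k u"
      using le I by (auto simp: AE_restrict_space_iff elim!: eventually_mono)
    have "\<bar>integral\<^sup>L (lebesgue_on ?I) g\<bar> \<le> integral\<^sup>L (lebesgue_on ?I) (\<lambda>u. \<bar>g u\<bar>)"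
      by (rule integral_abs_bound)
    also have "\<dots> \<le> integral\<^sup>L (lebesgue_on ?I) k" using int ae by (intro integral_mono_AE) auto
    finally show ?thesis using int unfolding primitive_diff[OF g T that] primitive_diff[OF k T that]
      by (simp add: lebesgue_integral_eq_integral)
  qed
  show ?thesis using *[of s t] *[of t s] by (cases "s \<le> t") auto
qed

text \<open>This places the values of the solution map in the compact convex sets above.\<close>

lemma primitive_dominated:
  assumes g: "integrable (lebesgue_on {0..T}) g" and k: "integrable (lebesgue_on {0..T}) k"
    and T: "0 \<le> T" and le: "AE t in lebesgue_on {0..T}. \<bar>g t\<bar> \<le> k t"
  shows "primitive T c g \<in> bcontfun" "Bcontfun (primitive T c g) \<in> dominated_bcontfun c (primitive T 0 k)"
proof -
  note * = primitive_increment_le[OF assms, where d=0]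
  show "primitive T c g \<in> bcontfun"
    by (rule dominated_in_bcontfun[OF continuous_on_primitive[OF k T] primitive_clamp[OF T] T *])
  then show "Bcontfun (primitive T c g) \<in> dominated_bcontfun c (primitive T 0 k)"
    using * T by (simp add: dominated_bcontfun_def Bcontfun_inverse)
qed

text \<open>Turns L^1 convergence of derivatives into uniform convergence of primitives; with the
  zero function for \<open>g\<close> it also yields uniform bounds.\<close>

lemma primitive_diff_le:
  assumes f: "integrable (lebesgue_on {0..T}) f" and g: "integrable (lebesgue_on {0..T}) g" and T: "0 \<le> T"
  shows "\<bar>primitive T c f t - primitive T c g t\<bar> \<le> (\<integral>t. \<bar>f t - g t\<bar> \<partial>lebesgue_on {0..T})"
proof -
  let ?I = "{0..clamp_interval T t}"
  have I: "?I \<subseteq> {0..T}" using T by (auto simp: clamp_interval_def)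
  have int: "integrable (lebesgue_on ?I) f" "integrable (lebesgue_on ?I) g"
    using lebesgue_on_integrable_subinterval[OF _ I] f g by (auto simp: set_integrable_def integrable_restrict_space)
  have "primitive T c f t - primitive T c g t = integral\<^sup>L (lebesgue_on ?I) (\<lambda>t. f t - g t)"
    using int by (simp add: primitive_def lebesgue_integral_eq_integral)
  also have "\<bar>\<dots>\<bar> \<le> integral\<^sup>L (lebesgue_on ?I) (\<lambda>t. \<bar>f t - g t\<bar>)" by (rule integral_abs_bound)
  also have "\<dots> = integral ?I (\<lambda>t. \<bar>f t - g t\<bar>)" using int by (intro lebesgue_integral_eq_integral) auto
  also have "\<dots> \<le> integral {0..T} (\<lambda>t. \<bar>f t - g t\<bar>)"
    using int f g by (intro integral_subset_le[OF I] integrable_on_lebesgue_on) auto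
  also have "\<dots> = (\<integral>t. \<bar>f t - g t\<bar> \<partial>lebesgue_on {0..T})" using f g by (intro lebesgue_integral_eq_integral[symmetric]) auto
  finally show ?thesis .
qed

text \<open>Needed so that \<open>A\<close> may be evaluated at every point of the compact set,
  including points obtained only as uniform limits. Domination by a primitive of \<open>k\<close>
  yields a density bounded by \<open>k\<close>, which is therefore in L^p.\<close>

lemma dominated_bcontfun_W1p:
  fixes x :: "real \<Rightarrow>\<^sub>C real"
  assumes k: "k \<in> borel_measurable borel" "\<And>t. 0 \<le> k t" "Lp_on p T k" and "1 \<le> p" "0 \<le> T"
    and x: "x \<in> dominated_bcontfun c (primitive T d k)"
  shows "W1p p T x"
proof -
  define H where "H = primitive T d k"
  \<comment> \<open>The cut-off makes \<open>k\<close> integrable on the line and matches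
    \<open>H\<close>, which is constant outside \<open>{0..T}\<close>.\<close>
  define k' where "k' t = indicator {0..T} t * k t" for t
  have xH: "\<bar>x s - x t\<bar> \<le> \<bar>H s - H t\<bar>" for s t using x by (simp add: dominated_bcontfun_def H_def)
  have kint: "integrable (lebesgue_on {0..T}) k" using Lp_on_integrable k(3) \<open>1 \<le> p\<close> by blast
  have "integrable lebesgue k'" unfolding k'_def
    using kint by (simp add: integrable_restrict_space)
  moreover have k'm[measurable]: "k' \<in> borel_measurable borel" unfolding k'_def using k(1) by measurable
  ultimately have k'int: "integrable lborel k'" by (simp add: integrable_completion)
  have Hc: "continuous_on UNIV H"
  proof -
    have "H \<in> bcontfun" unfolding H_def
      using primitive_dominated(1)[OF kint kint \<open>0 \<le> T\<close>] k(2) by simp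
    then show ?thesis by (simp add: bcontfun_def)
  qed
  \<comment> \<open>Bridges the half-open intervals of Stieltjes measures and the closed intervals
    in \<open>primitive\<close>; the missing endpoint is negligible.\<close>
  have lbint: "set_lebesgue_integral lborel {s<..t} g = integral {s..t} g" if "integrable lborel g" for g :: "real \<Rightarrow> real" and s t
  proof -
    have "set_integrable lborel {s<..t} g" unfolding set_integrable_def
      by (rule integrable_mult_indicator[OF _ that]) simp
    then have "set_lebesgue_integral lborel {s<..t} g = integral {s<..t} g"
      by (rule set_borel_integral_eq_integral(2))
    also have "\<dots> = integral {s..t} g"
      by (rule integral_spike_set) (auto intro: negligible_subset[of "{s}"])
    finally show ?thesis .
  qed
  have Hdiff: "set_lebesgue_integral lborel {s<..t} k' = H t - H s" if "s \<le> t" for s t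
  proof -
    have "set_lebesgue_integral lborel {s<..t} k' = integral {s..t} k'" by (rule lbint[OF k'int])
    also have "\<dots> = integral {s..t} (\<lambda>u. if u \<in> {0..T} then k u else 0)"
      by (rule arg_cong[where f = "integral _"]) (auto simp: k'_def indicator_def)
    also have "\<dots> = integral ({0..T} \<inter> {s..t}) k" by (rule integral_restrict_Int)
    also have "\<dots> = integral {clamp_interval T s..clamp_interval T t} k"
    proof (cases "s \<le> T \<and> 0 \<le> t")
      case True
      then have "{0..T} \<inter> {s..t} = {clamp_interval T s..clamp_interval T t}"
        using that \<open>0 \<le> T\<close> by (auto simp: clamp_interval_def)
      then show ?thesis by (rule arg_cong)
    next
      case False
      then have "{0..T} \<inter> {s..t} = {}" "clamp_interval T s = clamp_interval T t"
        using that \<open>0 \<le> T\<close> by (auto simp: clamp_interval_def)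
      then show ?thesis by simp
    qed
    also have "\<dots> = H t - H s" unfolding H_def by (rule primitive_diff[symmetric]) (use kint that assms in auto)
    finally show ?thesis .
  qed
  have Hmono: "H s \<le> H t" if "s \<le> t" for s t
  proof -
    have "0 \<le> set_lebesgue_integral lborel {s<..t} k'" unfolding set_lebesgue_integral_def
      using k(2) by (intro integral_nonneg_AE AE_I2) (simp add: k'_def)
    then show ?thesis using Hdiff[OF that] by simp
  qed
  have xc: "continuous_on UNIV x" by simp
  have xH': "\<bar>x t - x s\<bar> \<le> H t - H s" if "s \<le> t" for s t using xH[of t s] Hmono[OF that] by simp
  have k'0: "0 \<le> k' t" for t using k(2) by (simp add: k'_def)
  obtain g where g: "g \<in> borel_measurable borel" "\<And>t. \<bar>g t\<bar> \<le> k' t"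
    "\<And>s t. s \<le> t \<Longrightarrow> set_lebesgue_integral lborel {s<..t} g = x t - x s"
    using dominated_increments_density[OF k'int k'0 Hc Hdiff xc xH'] by blast
  have gm: "g \<in> borel_measurable (lebesgue_on {0..T})"
    using g(1) by (intro measurable_restrict_space1 measurable_completion) simp
  have gk: "\<bar>g t\<bar> \<le> \<bar>k t\<bar>" for t
    using g(2)[of t] k(2)[of t] by (cases "t \<in> {0..T}") (auto simp: k'_def)
  have "Lp_on p T g"
    using gk \<open>1 \<le> p\<close> by (intro Lp_on_mono[OF k(3) _ gm] AE_I2) auto
  moreover have "integrable lborel g"
    by (rule Bochner_Integration.integrable_bound[OF k'int]) (use g k'0 in auto)
  then have "x t = x 0 + integral {0..t} g" if "t \<in> {0..T}" for t
    using g(3)[of 0 t] that by (simp add: lbint)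
  ultimately show ?thesis unfolding W1p_def W1p_deriv_def by blast
qed

subsection \<open>Existence of a solution\<close>

lemma strict_mono_homeomorphism_inverse:
  fixes \<Phi> :: "real \<Rightarrow> real"
  assumes "strict_mono \<Phi>" "homeomorphism UNIV UNIV \<Phi> \<Psi>"
  shows "continuous_on UNIV \<Psi>" "\<And>u. \<Phi> (\<Psi> u) = u" "\<And>u v. \<Psi> u \<le> \<Psi> v \<longleftrightarrow> u \<le> v"
proof -
  show "continuous_on UNIV \<Psi>" and inv: "\<Phi> (\<Psi> u) = u" for u
    using assms(2) by (auto simp: homeomorphism_def)
  show "\<Psi> u \<le> \<Psi> v \<longleftrightarrow> u \<le> v" for u v
    using strict_mono_less_eq[OF assms(1), of "\<Psi> u" "\<Psi> v"] inv by simp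
qed

text \<open>Since \<open>1 / 0 = 0\<close> in HOL, L^p membership of \<open>1 / h1\<close> and
  \<open>1 / h2\<close> does not by itself express that these functions are positive a.e., so this
  is stated separately. The Sobolev norm in the continuity of \<open>F\<close> is the sum of the L^p
  norms of function and derivative.\<close>

theorem theorem2p5:
  fixes T p \<nu>1 \<nu>2 :: real
    and \<Phi> :: "real \<Rightarrow> real"
    and A F :: "(real \<Rightarrow> real) \<Rightarrow> real \<Rightarrow> real"
    and h1 h2 \<psi> :: "real \<Rightarrow> real"
  assumes T: "T > 0" and p: "p > 1"
    and H1: "strict_mono \<Phi>" "\<exists>\<Psi>. homeomorphism UNIV UNIV \<Phi> \<Psi>"
    and H2_C: "\<And>x. W1p p T x \<Longrightarrow> continuous_on {0..T} (A x)"
    and H2_cont: "\<And>x \<epsilon>. W1p p T x \<Longrightarrow> \<epsilon> > 0 \<Longrightarrow> \<exists>\<delta>>0. \<forall>y. W1p p T y \<longrightarrow>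
                    (\<forall>t\<in>{0..T}. \<bar>y t - x t\<bar> < \<delta>) \<longrightarrow> (\<forall>t\<in>{0..T}. \<bar>A y t - A x t\<bar> < \<epsilon>)"
    and H2_h: "continuous_on {0..T} h1" "continuous_on {0..T} h2"
      "\<forall>t\<in>{0..T}. h1 t \<ge> 0" "\<forall>t\<in>{0..T}. h2 t \<ge> 0"
      "AE t in lebesgue_on {0..T}. h1 t > 0" "AE t in lebesgue_on {0..T}. h2 t > 0"
      "Lp_on p T (\<lambda>t. 1 / h1 t)" "Lp_on p T (\<lambda>t. 1 / h2 t)"
    and H2_bd: "\<And>x t. W1p p T x \<Longrightarrow> t \<in> {0..T} \<Longrightarrow> h1 t \<le> A x t \<and> A x t \<le> h2 t"
    and H3_L1: "\<And>x. W1p p T x \<Longrightarrow> integrable (lebesgue_on {0..T}) (F x)"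
    and H3_cont: "\<And>x g \<epsilon>. W1p_deriv p T x g \<Longrightarrow> \<epsilon> > 0 \<Longrightarrow> \<exists>\<delta>>0. \<forall>y h. W1p_deriv p T y h \<longrightarrow>
                    Lp_norm p T (\<lambda>t. y t - x t) + Lp_norm p T (\<lambda>t. h t - g t) < \<delta> \<longrightarrow>
                    integral\<^sup>L (lebesgue_on {0..T}) (\<lambda>t. \<bar>F y t - F x t\<bar>) < \<epsilon>"
    and H3_psi: "integrable (lebesgue_on {0..T}) \<psi>" "\<forall>t\<in>{0..T}. \<psi> t \<ge> 0"
      "\<And>x. W1p p T x \<Longrightarrow> AE t in lebesgue_on {0..T}. \<bar>F x t\<bar> \<le> \<psi> t"
  shows "\<exists>x. W1p p T x \<and> is_solution p T \<Phi> A F \<nu>1 \<nu>2 x"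
proof -
  obtain \<Psi> where "homeomorphism UNIV UNIV \<Phi> \<Psi>" using H1(2) by blast
  note \<Psi> = strict_mono_homeomorphism_inverse[OF H1(1) this]
  let ?M = "lebesgue_on {0..T}"

  \<comment> \<open>Constants, a priori bounds and the two compact sets\<close>
  have T0: "0 \<le> T" and p1: "1 \<le> p" using T p by auto
  define m where "m = (\<integral>t. \<psi> t \<partial>?M)"
  have "bounded (h2 ` {0..T})" using H2_h(2) by (simp add: compact_continuous_image compact_imp_bounded)
  then obtain B where B: "B > 0" "\<And>t. t \<in> {0..T} \<Longrightarrow> h2 t \<le> B"
    unfolding bounded_pos by (metis abs_le_D1 image_eqI real_norm_def)
  \<comment> \<open>\<open>R\<close> is so large that \<open>\<xi> = R\<close> forces \<open>x T > \<nu>2\<close> and \<open>\<xi> = - R\<close> forces \<open>x T < \<nu>2\<close>.\<close>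
  define c where "c = \<bar>\<nu>2 - \<nu>1\<bar> * B / T + 1"
  define R where "R = m + max \<bar>\<Phi> c\<bar> \<bar>\<Phi> (- c)\<bar> + 1"
  \<comment> \<open>As \<open>\<Psi>\<close> is increasing, its values at the two ends bound it on
    \<open>[- R - m, R + m]\<close>, the range of \<open>\<xi> + w\<close>.\<close>
  define N where "N = max \<bar>\<Psi> (R + m)\<bar> \<bar>\<Psi> (- R - m)\<bar>"
  have m0: "m \<ge> 0" unfolding m_def using H3_psi(2) by (intro integral_nonneg_AE AE_I2) simp
  have R0: "R > 0" using m0 by (simp add: R_def)
  have c0: "c > 0" unfolding c_def using B(1) T by (simp add: add_nonneg_pos)
  have \<Phi>\<Psi>: "\<Psi> (\<Phi> u) = u" for u using \<open>homeomorphism UNIV UNIV \<Phi> \<Psi>\<close> by (simp add: homeomorphism_def)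
  have Rc: "\<Psi> u \<ge> c" if "u \<ge> R - m" for u
    using that \<Psi>(3)[of "\<Phi> c" u] by (simp add: \<Phi>\<Psi> R_def)
  have Rc': "\<Psi> u \<le> - c" if "u \<le> - R + m" for u
    using that \<Psi>(3)[of u "\<Phi> (- c)"] by (simp add: \<Phi>\<Psi> R_def)
  have \<Psi>N: "\<bar>\<Psi> u\<bar> \<le> N" if "\<bar>u\<bar> \<le> R + m" for u
    using that \<Psi>(3)[of u "R + m"] \<Psi>(3)[of "- R - m" u] by (auto simp: N_def)
  have N0: "N \<ge> 0" by (simp add: N_def)
  \<comment> \<open>The bound for \<open>y'\<close>. Clamping the argument makes the denominator
    continuous on the line, hence \<open>k\<close> Borel measurable, although \<open>h1\<close> is
    controlled only on \<open>{0..T}\<close>.\<close>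
  define k where "k t = N / h1 (clamp_interval T t)" for t
  define K1 where "K1 = dominated_bcontfun \<nu>1 (primitive T 0 k)"
  define K2 where "K2 = dominated_bcontfun 0 (primitive T 0 \<psi>)"
  have k0: "0 \<le> k t" for t
    using H2_h(3) N0 clamp_interval_mem[OF T0, of t] by (simp add: k_def)
  have kLp: "Lp_on p T k"
  proof -
    have "Lp_on p T (\<lambda>t. N * (1 / h1 t))" by (rule Lp_on_cmult[OF H2_h(7)])
    moreover have "Lp_on p T (\<lambda>t. N * (1 / h1 t)) \<longleftrightarrow> Lp_on p T k"
      unfolding Lp_on_def
      by (intro arg_cong2[where f = "(\<and>)"] measurable_cong Bochner_Integration.integrable_cong)
        (auto simp: k_def)
    ultimately show ?thesis by simp
  qed
  note kint = Lp_on_integrable[OF kLp p1]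
  have km: "k \<in> borel_measurable borel"
  proof -
    have "continuous_on UNIV (\<lambda>t. h1 (clamp_interval T t))"
      using clamp_interval_mem[OF T0] by (intro continuous_on_compose2[OF H2_h(1)])
        (auto simp: clamp_interval_def intro!: continuous_intros)
    then show ?thesis unfolding k_def by (intro borel_measurable_divide borel_measurable_continuous_onI) auto
  qed
  have W1p_K1: "W1p p T x" if "x \<in> K1" for x :: "real \<Rightarrow>\<^sub>C real"
    using dominated_bcontfun_W1p[OF km k0 kLp p1 T0] that by (simp add: K1_def)
  have K2_bd: "\<bar>w t\<bar> \<le> m" if "w \<in> K2" for w :: "real \<Rightarrow>\<^sub>C real" and t
  proof -
    have "\<bar>w t - w 0\<bar> \<le> \<bar>primitive T 0 \<psi> t - primitive T 0 \<psi> 0\<bar>"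
      using that by (simp only: K2_def dominated_bcontfun_def) blast
    also have "primitive T 0 \<psi> 0 = primitive T 0 (\<lambda>_. 0) t" using T0 by (simp add: primitive_def)
    also have "\<bar>primitive T 0 \<psi> t - primitive T 0 (\<lambda>_. 0) t\<bar> \<le> (\<integral>t. \<bar>\<psi> t - 0\<bar> \<partial>?M)"
      by (rule primitive_diff_le[OF H3_psi(1) _ T0]) simp
    also have "\<dots> = m" unfolding m_def using H3_psi(2) by (intro Bochner_Integration.integral_cong) auto
    finally show ?thesis using that by (simp add: K2_def dominated_bcontfun_def)
  qed

  \<comment> \<open>The solution map and its invariant set\<close>
  define S where "S = {- R..R} \<times> K2 \<times> K1"
  define G where "G s t = \<Psi> (fst s + apply_bcontfun (fst (snd s)) t) / A (apply_bcontfun (snd (snd s))) t"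
    for s :: "real \<times> (real \<Rightarrow>\<^sub>C real) \<times> (real \<Rightarrow>\<^sub>C real)" and t
  define Y where "Y s = Bcontfun (primitive T \<nu>1 (G s))" for s
  \<comment> \<open>\<open>F\<close> is evaluated at the new \<open>Y s\<close>, not at the third
    component of \<open>s\<close>: the latter converges only uniformly, while \<open>Y s\<close>
    converges together with its derivative, as the continuity of \<open>F\<close> demands.\<close>
  define W where "W s = Bcontfun (primitive T 0 (F (Y s)))" for s
  define f where "f s = (max (- R) (min R (fst s + \<nu>2 - Y s T)), W s, Y s)" for s
  \<comment> \<open>At such points \<open>A x t \<ge> h1 t > 0\<close>, so the quotient in
    \<open>G\<close> is a genuine division.\<close>
  have AE_I: "AE t in ?M. t \<in> {0..T} \<and> h1 t > 0"
    using H2_h(5) AE_space[of ?M] by eventually_elim simp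
  have Gm: "G s \<in> borel_measurable ?M" and Gk: "AE t in ?M. \<bar>G s t\<bar> \<le> k t" if "s \<in> S" for s
  proof -
    obtain \<xi> w x where s: "s = (\<xi>, w, x)" by (metis prod.exhaust)
    have x: "W1p p T x" and w: "w \<in> K2" and \<xi>: "\<bar>\<xi>\<bar> \<le> R" using that s W1p_K1 by (auto simp: S_def)
    have "continuous_on {0..T} (\<lambda>t. \<Psi> (\<xi> + w t))"
      by (intro continuous_on_compose2[OF \<Psi>(1)] continuous_intros) auto
    then have "(\<lambda>t. \<Psi> (\<xi> + w t)) \<in> borel_measurable ?M"
      by (intro continuous_imp_measurable_on_sets_lebesgue) auto
    moreover have "A x \<in> borel_measurable ?M"
      by (intro continuous_imp_measurable_on_sets_lebesgue H2_C x) auto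
    ultimately show "G s \<in> borel_measurable ?M" unfolding G_def s by simp
    show "AE t in ?M. \<bar>G s t\<bar> \<le> k t"
      using AE_I
    proof eventually_elim
      fix t assume t: "t \<in> {0..T} \<and> h1 t > 0"
      have "\<bar>\<Psi> (\<xi> + w t)\<bar> \<le> N" using K2_bd[OF w, of t] \<xi> by (intro \<Psi>N) linarith
      then show "\<bar>G s t\<bar> \<le> k t"
        using H2_bd[OF x, of t] t N0 by (auto simp: G_def s k_def abs_divide intro!: frac_le)
    qed
  qed
  have GLp: "Lp_on p T (G s)" if "s \<in> S" for s
    using Gk[OF that] p1 k0 by (intro Lp_on_mono[OF kLp _ Gm[OF that]]) auto
  note Gint = Lp_on_integrable[OF GLp p1]
  have Y: "apply_bcontfun (Y s) = primitive T \<nu>1 (G s)" "Y s \<in> K1" if "s \<in> S" for s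
    using primitive_dominated[OF Gint[OF that] kint T0 Gk[OF that]]
    by (auto simp: Y_def K1_def Bcontfun_inverse)
  have Yd: "W1p_deriv p T (Y s) (G s)" if "s \<in> S" for s
    using GLp[OF that] T0 by (auto simp: W1p_deriv_def Y[OF that] primitive_def)
  have YW: "W1p p T (Y s)" if "s \<in> S" for s using Yd[OF that] by (auto simp: W1p_def)
  have W: "apply_bcontfun (W s) = primitive T 0 (F (Y s))" "W s \<in> K2" if "s \<in> S" for s
    using primitive_dominated[OF H3_L1 H3_psi(1) T0 H3_psi(3), OF YW[OF that] YW[OF that]]
    by (auto simp: W_def K2_def Bcontfun_inverse)
  have fS: "f ` S \<subseteq> S" using W(2) Y(2) R0 by (auto simp: f_def S_def)

  \<comment> \<open>Continuity of the solution map\<close>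
  have contf: "continuous_on S f"
    unfolding continuous_on_sequentially
  proof (intro ballI allI impI, elim conjE)
    fix s and sn :: "nat \<Rightarrow> _" assume s: "s \<in> S" and sn: "\<forall>n. sn n \<in> S" and lim: "sn \<longlonglongrightarrow> s"
    have snS: "sn n \<in> S" for n using sn by simp
    define \<xi> where "\<xi> = fst s" define w where "w = fst (snd s)" define x where "x = snd (snd s)"
    define \<xi>n where "\<xi>n n = fst (sn n)" for n
    define wn where "wn n = fst (snd (sn n))" for n
    define xn where "xn n = snd (snd (sn n))" for n
    have l: "\<xi>n \<longlonglongrightarrow> \<xi>" "wn \<longlonglongrightarrow> w" "xn \<longlonglongrightarrow> x"
      using lim unfolding \<xi>n_def wn_def xn_def \<xi>_def w_def x_def by (auto intro!: tendsto_intros)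
    have xW: "W1p p T x" and xnW: "W1p p T (xn n)" for n
      using s snS[of n] by (auto simp: S_def x_def xn_def intro: W1p_K1)
    have "AE t in ?M. (\<lambda>n. G (sn n) t) \<longlonglongrightarrow> G s t"
      using AE_I
    proof eventually_elim
      fix t assume t: "t \<in> {0..T} \<and> h1 t > 0"
      have "(\<lambda>n. A (xn n) t) \<longlonglongrightarrow> A x t"
      proof (rule tendstoI)
        fix e :: real assume "e > 0"
        then obtain d where d: "d > 0" "\<And>y. W1p p T y \<Longrightarrow> (\<forall>t\<in>{0..T}. \<bar>y t - x t\<bar> < d) \<Longrightarrow> (\<forall>t\<in>{0..T}. \<bar>A y t - A x t\<bar> < e)"
          using H2_cont[OF xW] by meson
        have "\<forall>\<^sub>F n in sequentially. dist (xn n) x < d" using l(3) d(1) by (rule tendstoD)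
        then show "\<forall>\<^sub>F n in sequentially. dist (A (xn n) t) (A x t) < e"
        proof eventually_elim
          fix n assume "dist (xn n) x < d"
          then have "\<forall>t\<in>{0..T}. \<bar>xn n t - x t\<bar> < d"
            using dist_bounded[of "xn n" _ x] by (auto simp: dist_real_def intro: le_less_trans)
          then show "dist (A (xn n) t) (A x t) < e" using d(2)[OF xnW] t by (simp add: dist_real_def)
        qed
      qed
      moreover have "(\<lambda>n. wn n t) \<longlonglongrightarrow> w t"
        using tendsto_bcontfun_uniform_limit[OF l(2)] by (rule tendsto_uniform_limitI) simp
      then have "(\<lambda>n. \<Psi> (\<xi>n n + wn n t)) \<longlonglongrightarrow> \<Psi> (\<xi> + w t)"
        using \<Psi>(1) l(1) by (intro isCont_tendsto_compose[where g = \<Psi>] tendsto_intros)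
          (auto simp: continuous_on_eq_continuous_at)
      ultimately have "(\<lambda>n. \<Psi> (\<xi>n n + wn n t) / A (xn n) t) \<longlonglongrightarrow> \<Psi> (\<xi> + w t) / A x t"
        using H2_bd[OF xW, of t] t by (intro tendsto_divide) auto
      then show "(\<lambda>n. G (sn n) t) \<longlonglongrightarrow> G s t"
        by (simp add: G_def \<xi>_def \<xi>n_def w_def wn_def x_def xn_def)
    qed
    \<comment> \<open>The exponent is left open: 1 gives uniform convergence of \<open>Y\<close>,
      and \<open>p\<close> gives the derivative term of the Sobolev norm.\<close>
    note GL = Lp_dominated_convergence[OF _ _ Gm[OF s] Gk[OF s] Gm[OF snS] Gk[OF snS] this]
    have "(\<lambda>n. \<integral>t. \<bar>G (sn n) t - G s t\<bar> powr 1 \<partial>?M) \<longlonglongrightarrow> 0"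
      by (rule GL(1)) (auto simp: Lp_on_one_iff kint)
    then have G1: "(\<lambda>n. \<integral>t. \<bar>G (sn n) t - G s t\<bar> \<partial>?M) \<longlonglongrightarrow> 0" by simp
    have G2: "(\<lambda>n. Lp_norm p T (\<lambda>t. G (sn n) t - G s t)) \<longlonglongrightarrow> 0" by (rule GL(2)[OF p1 kLp])
    have Ylim: "(\<lambda>n. Y (sn n)) \<longlonglongrightarrow> Y s"
    proof (rule metric_tendsto_imp_tendsto[OF G1])
      have "dist (Y (sn n)) (Y s) \<le> (\<integral>t. \<bar>G (sn n) t - G s t\<bar> \<partial>?M)" for n
        by (rule dist_bound) (use primitive_diff_le[OF Gint[OF snS] Gint[OF s] T0] in
            \<open>simp add: Y(1)[OF snS] Y(1)[OF s] dist_real_def\<close>)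
      then show "\<forall>\<^sub>F n in sequentially. dist (Y (sn n)) (Y s) \<le> dist (\<integral>t. \<bar>G (sn n) t - G s t\<bar> \<partial>?M) 0"
        by (intro always_eventually allI) (simp add: dist_real_def)
    qed
    have Ypt: "(\<lambda>n. Y (sn n) t) \<longlonglongrightarrow> Y s t" for t
      using tendsto_bcontfun_uniform_limit[OF Ylim] by (rule tendsto_uniform_limitI) simp
    have Y2: "(\<lambda>n. Lp_norm p T (\<lambda>t. Y (sn n) t - Y s t)) \<longlonglongrightarrow> 0"
    proof (rule Lp_dominated_convergence(2)[OF p1])
      define b where "b = \<bar>\<nu>1\<bar> + (\<integral>t. \<bar>k t - 0\<bar> \<partial>?M)"
      show "Lp_on p T (\<lambda>_. b)" by (simp add: Lp_on_def)
      have Yb: "\<bar>Y s t\<bar> \<le> b" if "s \<in> S" for s t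
      proof -
        have "\<bar>Y s t - Y s 0\<bar> \<le> \<bar>primitive T 0 k t - primitive T 0 k 0\<bar>" "Y s 0 = \<nu>1"
          using Y(2)[OF that] unfolding K1_def dominated_bcontfun_def by blast+
        moreover have "primitive T 0 k 0 = primitive T 0 (\<lambda>_. 0) t" using T0 by (simp add: primitive_def)
        ultimately show ?thesis
          using primitive_diff_le[OF kint _ T0, of "\<lambda>_. 0" 0 t] by (simp add: b_def)
      qed
      show "AE t in ?M. \<bar>Y s t\<bar> \<le> b" "AE t in ?M. \<bar>Y (sn n) t\<bar> \<le> b" for n
        using Yb s snS by auto
      show "apply_bcontfun (Y s) \<in> borel_measurable ?M" "apply_bcontfun (Y (sn n)) \<in> borel_measurable ?M" for n
        by (intro continuous_imp_measurable_on_sets_lebesgue; simp)+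
      show "AE t in ?M. (\<lambda>n. Y (sn n) t) \<longlonglongrightarrow> Y s t" using Ypt by simp
    qed
    have F1: "(\<lambda>n. \<integral>t. \<bar>F (Y (sn n)) t - F (Y s) t\<bar> \<partial>?M) \<longlonglongrightarrow> 0"
    proof (rule tendstoI)
      fix e :: real assume "e > 0"
      then obtain d where d: "d > 0" "\<And>y h. W1p_deriv p T y h \<Longrightarrow>
          Lp_norm p T (\<lambda>t. y t - Y s t) + Lp_norm p T (\<lambda>t. h t - G s t) < d \<Longrightarrow>
          (\<integral>t. \<bar>F y t - F (Y s) t\<bar> \<partial>?M) < e"
        using H3_cont[OF Yd[OF s]] by meson
      have "(\<lambda>n. Lp_norm p T (\<lambda>t. Y (sn n) t - Y s t) + Lp_norm p T (\<lambda>t. G (sn n) t - G s t)) \<longlonglongrightarrow> 0 + 0"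
        by (intro tendsto_add Y2 G2)
      then have "\<forall>\<^sub>F n in sequentially. Lp_norm p T (\<lambda>t. Y (sn n) t - Y s t) + Lp_norm p T (\<lambda>t. G (sn n) t - G s t) < d"
        using d(1) by (intro order_tendstoD) auto
      then show "\<forall>\<^sub>F n in sequentially. dist (\<integral>t. \<bar>F (Y (sn n)) t - F (Y s) t\<bar> \<partial>?M) 0 < e"
        by eventually_elim (use d(2)[OF Yd[OF snS]] in \<open>simp add: dist_real_def\<close>)
    qed
    have Wlim: "(\<lambda>n. W (sn n)) \<longlonglongrightarrow> W s"
    proof (rule metric_tendsto_imp_tendsto[OF F1])
      have "dist (W (sn n)) (W s) \<le> (\<integral>t. \<bar>F (Y (sn n)) t - F (Y s) t\<bar> \<partial>?M)" for n
        by (rule dist_bound) (use primitive_diff_le[OF H3_L1[OF YW[OF snS]] H3_L1[OF YW[OF s]] T0] in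
            \<open>simp add: W(1)[OF snS] W(1)[OF s] dist_real_def\<close>)
      then show "\<forall>\<^sub>F n in sequentially. dist (W (sn n)) (W s) \<le> dist (\<integral>t. \<bar>F (Y (sn n)) t - F (Y s) t\<bar> \<partial>?M) 0"
        by (intro always_eventually allI) (simp add: dist_real_def)
    qed
    show "(f \<circ> sn) \<longlonglongrightarrow> f s"
      unfolding f_def o_def
      by (intro tendsto_Pair tendsto_max tendsto_min tendsto_add tendsto_diff tendsto_const Ypt Wlim Ylim
          l(1)[unfolded \<xi>n_def \<xi>_def])
  qed

  \<comment> \<open>The fixed point and its boundary value\<close>
  have compS: "compact S" "convex S"
    unfolding S_def K1_def K2_def
    by (intro compact_Times convex_Times compact_dominated_bcontfun[OF continuous_on_primitive primitive_clamp]
        convex_dominated_bcontfun kint H3_psi(1) T0 compact_Icc convex_real_interval)+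
  have "AE t in ?M. 0 \<le> \<psi> t" using H3_psi(2) by (intro AE_I2) simp
  then have "(0, Bcontfun (primitive T 0 (\<lambda>_. 0)), Bcontfun (primitive T \<nu>1 (\<lambda>_. 0))) \<in> S"
    using primitive_dominated(2)[OF _ kint T0, of "\<lambda>_. 0"] primitive_dominated(2)[OF _ H3_psi(1) T0, of "\<lambda>_. 0"]
      k0 R0 by (simp add: S_def K1_def K2_def)
  then have "S \<noteq> {}" by blast
  then obtain s where s: "s \<in> S" "f s = s"
    using Schauder_fixpoint[OF compS _ contf fS] by blast
  define \<xi> where "\<xi> = fst s"
  define w where "w = fst (snd s)"
  define x where "x = snd (snd s)"
  have s_eq: "s = (\<xi>, w, x)" by (simp add: \<xi>_def w_def x_def)
  have fixed: "\<xi> = max (- R) (min R (\<xi> + \<nu>2 - x T))" "w = W s" "x = Y s"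
    using s(2) unfolding f_def by (auto simp: s_eq)
  have xW: "W1p p T x" using YW[OF s(1)] fixed(3) by simp
  have w: "apply_bcontfun w = primitive T 0 (F x)" "\<bar>w t\<bar> \<le> m" for t
    using W[OF s(1)] fixed(2,3) K2_bd[of w t] by simp_all
  have x0: "x 0 = \<nu>1" using Y(1)[OF s(1)] fixed(3) T0 by simp
  have G: "G s t = \<Psi> (\<xi> + w t) / A x t" for t by (simp add: G_def s_eq)
  have xT: "x T = \<nu>1 + (\<integral>t. G s t \<partial>?M)"
    using Y(1)[OF s(1)] fixed(3) T Gint[OF s(1)] by (simp add: primitive_def lebesgue_integral_eq_integral)
  have const: "(\<integral>t. a / B \<partial>?M) = a * T / B" for a
    using T by (subst lebesgue_integral_eq_integral) auto
  \<comment> \<open>\<open>A x \<le> h2 \<le> B\<close>, so a slope of size at least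
    \<open>c / B\<close> and of constant sign changes \<open>x\<close> by at least
    \<open>c * T / B\<close>, more than the prescribed
    \<open>\<bar>\<nu>2 - \<nu>1\<bar>\<close>.\<close>
  have cB: "c * T / B > \<bar>\<nu>2 - \<nu>1\<bar>"
    using B(1) T by (simp add: c_def field_simps)
  \<comment> \<open>The absolutely continuous representative of
    \<open>\<Phi> (A x t * x' t)\<close>, with derivative \<open>F x\<close>.\<close>
  define u where "u t = \<xi> + w t" for t
  have "x T = \<nu>2"
  proof (rule ccontr)
    assume "x T \<noteq> \<nu>2"
    \<comment> \<open>A wrong end value pushes \<open>\<xi>\<close> in the direction of the error,
      so the fixed point equation can hold only at an end of \<open>[- R, R]\<close>. At
      \<open>R\<close> the argument of \<open>\<Psi>\<close> is at least \<open>R - m\<close>, the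
      slope at least \<open>c / B\<close>, and \<open>x\<close> overshoots \<open>\<nu>2\<close>;
      the case \<open>- R\<close> is symmetric.\<close>
    then consider "x T < \<nu>2" "\<xi> = R" | "x T > \<nu>2" "\<xi> = - R" using fixed(1) R0 by linarith
    then show False
    proof cases
      case 1
      have "(\<integral>t. c / B \<partial>?M) \<le> (\<integral>t. G s t \<partial>?M)"
      proof (intro integral_mono_AE Gint s(1))
        show "AE t in ?M. c / B \<le> G s t" using AE_I
        proof eventually_elim
          fix t assume t: "t \<in> {0..T} \<and> h1 t > 0"
          have "c \<le> \<Psi> (\<xi> + w t)" using w(2)[of t] 1 by (intro Rc) linarith
          then show "c / B \<le> G s t" unfolding G
            using H2_bd[OF xW, of t] B(2)[of t] t c0 by (intro frac_le) auto
        qed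
      qed simp
      then show False using 1 cB xT unfolding const by linarith
    next
      case 2
      have "(\<integral>t. G s t \<partial>?M) \<le> (\<integral>t. (- c) / B \<partial>?M)"
      proof (intro integral_mono_AE Gint s(1))
        show "AE t in ?M. G s t \<le> (- c) / B" using AE_I
        proof eventually_elim
          fix t assume t: "t \<in> {0..T} \<and> h1 t > 0"
          have "c \<le> - \<Psi> (\<xi> + w t)" using w(2)[of t] 2 Rc'[of "\<xi> + w t"] by linarith
          then have "c / B \<le> - \<Psi> (\<xi> + w t) / A x t"
            using H2_bd[OF xW, of t] B(2)[of t] t c0 by (intro frac_le) auto
          then show "G s t \<le> (- c) / B" unfolding G by simp
        qed
      qed simp
      then show False using 2 cB xT unfolding const by simp
    qed
  qed
  moreover have "AE t in ?M. \<Phi> (A x t * G s t) = u t"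
    using AE_I
  proof eventually_elim
    fix t assume t: "t \<in> {0..T} \<and> h1 t > 0"
    then have "A x t \<noteq> 0" using H2_bd[OF xW, of t] by auto
    then show "\<Phi> (A x t * G s t) = u t" by (simp add: G u_def \<Psi>(2))
  qed
  moreover have "W1p_deriv 1 T u (F x)"
    using H3_L1[OF xW] T0 by (auto simp: W1p_deriv_def Lp_on_one_iff u_def w(1) primitive_def)
  moreover have "W1p_deriv p T x (G s)" using Yd[OF s(1)] fixed(3) by simp
  moreover have "AE t in ?M. F x t = F x t" "continuous_on {0..T} x" by simp_all
  ultimately have "is_solution p T \<Phi> A F \<nu>1 \<nu>2 x"
    using x0 unfolding is_solution_def by blast
  then show ?thesis using xW by blast
qed

end
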